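(* Assume that: (1) $c:\mathcal X\times\mathcal U\to\mathbb R$ is Borel measurable and $|c(x,u)|\le C_c<\infty$ for all $(x,u)$; (2) the action space $\mathcal U$ is compact; (3) the filtered cost $g:\mathcal I\times\mathcal U\to\mathbb R$ is lower semicontinuous; (4) the kernel $\mathcal K$ is weakly continuous: for every $v\in C_b(\mathcal I)$ the map $(I,u)\mapsto\int_{\mathcal I}v(I')\,\mathcal K(dI'\mid I,u)$ is continuous on $\mathcal I\times\mathcal U$. Then the optimal value $V^*$ is the unique bounded solution of $V=\mathcal BV$. Moreover, there exists a Borel measurable selector $f^*:\mathcal I\to\mathcal U$ such that $$V^*(I)=g(I,f^*(I))+\alpha\int_{\mathcal I}V^*(I')\,\mathcal K(dI'\mid I,f^*(I)),\qquad I\in\mathcal I,$$ and the stationary deterministic policy $U_t=f^*(I_t)$ is optimal: $J_{f^*}(I)=V^*(I)$ for all $I\in\mathcal I$.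
   Context: Model. $\mathcal X$ (states), $\mathcal U$ (actions), $\mathsf E$, $\mathsf V$ (noises) are standard Borel spaces, $G:\mathcal X\times\mathcal U\times\mathsf E\times\mathsf V\to\mathcal X$ is Borel measurable, $\nu_\eta,\nu_\varepsilon$ are probability measures on $\mathsf E,\mathsf V$, and $Q(C\mid x,u)=\int_{\mathsf E}\int_{\mathsf V}\mathbf 1_C(G(x,u,e,v))\,\nu_\varepsilon(dv)\,\nu_\eta(de)$. $\mathcal X$ and $\mathcal U$ carry Polish topologies generating their Borel $\sigma$-fields. $\mathcal P(\mathcal X)$ is the set of Borel probability measures on $\mathcal X$. The observable classes $O_1,\dots,O_{r+1}$ are pairwise disjoint measurable sets with union $\mathcal X$; $\mathsf J=\{j:O_j\neq\varnothing\}$. For $\mu\in\mathcal P(\mathcal X)$, $u\in\mathcal U$, $k\in\mathsf J$: $(\mathcal L_u\mu)(C)=\int_{\mathcal X}Q(C\mid x,u)\,\mu(dx)$; $p_k(\mu,u)=(\mathcal L_u\mu)(O_k)$; $\Phi_k(\mu,u)(C)=(\mathcal L_u\mu)(C\cap O_k)/p_k(\mu,u)$ if $p_k(\mu,u)>0$, and $\Phi_k(\mu,u)=\rho_k$ otherwise, where $\rho_k\in\mathcal P(\mathcal X)$ is fixed with $\rho_k(O_k)=1$. Information-state model. $\mathcal P_j=\{\mu\in\mathcal P(\mathcal X):\mu(O_j)=1\}$, $\mathcal I=\bigcup_{j\in\mathsf J}(\{j\}\times\mathcal P_j)$, endowed with the disjoint-union topology in which each $\mathcal P_j$ has the weak topology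 (inherited from $\mathcal P(\mathcal X)$), and $C_b(\mathcal I)$ is the set of bounded continuous real functions on $\mathcal I$. For $I=(j,\mu)$: $\mathcal K(D\mid I,u)=\sum_{k\in\mathsf J}p_k(\mu,u)\mathbf 1_D\bigl((k,\Phi_k(\mu,u))\bigr)$ and $g(I,u)=\int_{\mathcal X}c(x,u)\,\mu(dx)$. All actions $u\in\mathcal U$ are admissible at every $I$. Control problem. $\alpha\in(0,1)$ is fixed. $\Gamma$ is the set of randomized history-dependent policies $\boldsymbol\gamma=\{\gamma_t\}_{t\ge0}$, $\gamma_t$ a stochastic kernel on $\mathcal U$ given $(I_0,U_0,\dots,U_{t-1},I_t)$. $J_{\boldsymbol\gamma}(I)=\mathbb E_I^{\boldsymbol\gamma}[\sum_{t\ge0}\alpha^tg(I_t,U_t)]$ for the controlled Markov process with initial state $I$, kernel $\mathcal K$ and policy $\boldsymbol\gamma$; $V^*(I)=\inf_{\boldsymbol\gamma\in\Gamma}J_{\boldsymbol\gamma}(I)$. A Borel map $f:\mathcal I\to\mathcal U$ defines the stationary deterministic policy $U_t=f(I_t)$, with cost $J_f$. The Bellman operator acts on bounded Borel functions by $(\mathcal Bv)(I)=\inf_{u\in\mathcal U}\{g(I,u)+\alpha\int_{\mathcal I}v(I')\,\mathcal K(dI'\mid I,u)\}$. *)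

theory Defs
  imports "HOL-Probability.Probability"
begin

text \<open>
  A Polish space is a type of class \<open>polish_space\<close>; nothing below depends on the particular complete
  metric of the class, only on its topology. The standard Borel noise spaces carry some Polish
  topology generating their sigma-algebra, which enters only through \<^const>\<open>borel\<close>.
\<close>

record ('x, 'u, 'e, 'v) pomdp =
  num_r :: nat
  obs :: "nat \<Rightarrow> 'x set"
  dyn :: "'x \<times> 'u \<times> 'e \<times> 'v \<Rightarrow> 'x"
  law_eta :: "'e measure"
  law_eps :: "'v measure"
  rho :: "nat \<Rightarrow> 'x measure"
  cost :: "'x \<Rightarrow> 'u \<Rightarrow> real"
  disc :: real

definition prob_measures :: "'a::topological_space measure set" where
  "prob_measures = space (prob_algebra borel)"

definition classes :: "('x, 'u, 'e, 'v) pomdp \<Rightarrow> nat set" where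
  "classes M = {j \<in> {1..num_r M + 1}. obs M j \<noteq> {}}"

text \<open>Standing assumptions on the model; those on the cost are hypotheses of the theorem.\<close>

locale pomdp_model =
  fixes M :: "('x::polish_space, 'u::polish_space, 'e::polish_space, 'v::polish_space) pomdp"
  assumes dyn_measurable: "dyn M \<in> borel \<Otimes>\<^sub>M borel \<Otimes>\<^sub>M borel \<Otimes>\<^sub>M borel \<rightarrow>\<^sub>M borel"
    and law_eta: "law_eta M \<in> prob_measures"
    and law_eps: "law_eps M \<in> prob_measures"
    and obs_sets: "\<And>j. j \<in> {1..num_r M + 1} \<Longrightarrow> obs M j \<in> sets borel"
    and obs_disjoint: "disjoint_family_on (obs M) {1..num_r M + 1}"
    and obs_cover: "(\<Union>j\<in>{1..num_r M + 1}. obs M j) = UNIV"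
    and rho: "\<And>k. k \<in> classes M \<Longrightarrow> rho M k \<in> prob_measures \<and> measure (rho M k) (obs M k) = 1"
    and disc: "0 < disc M" "disc M < 1"


section \<open>State transition, prediction and filtering\<close>

definition trans_prob :: "('x::polish_space, 'u, 'e, 'v) pomdp \<Rightarrow> 'x \<Rightarrow> 'u \<Rightarrow> 'x measure" where
  "trans_prob M x u = measure_of UNIV (sets borel)
     (\<lambda>C. \<integral>\<^sup>+ e. (\<integral>\<^sup>+ v. indicator C (dyn M (x, u, e, v)) \<partial>law_eps M) \<partial>law_eta M)"

definition predict :: "('x::polish_space, 'u, 'e, 'v) pomdp \<Rightarrow> 'u \<Rightarrow> 'x measure \<Rightarrow> 'x measure" where
  "predict M u \<mu> = measure_of UNIV (sets borel) (\<lambda>C. \<integral>\<^sup>+ x. emeasure (trans_prob M x u) C \<partial>\<mu>)"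

definition obs_prob :: "('x::polish_space, 'u, 'e, 'v) pomdp \<Rightarrow> nat \<Rightarrow> 'x measure \<Rightarrow> 'u \<Rightarrow> real" where
  "obs_prob M k \<mu> u = measure (predict M u \<mu>) (obs M k)"

definition filter_upd ::
    "('x::polish_space, 'u, 'e, 'v) pomdp \<Rightarrow> nat \<Rightarrow> 'x measure \<Rightarrow> 'u \<Rightarrow> 'x measure" where
  "filter_upd M k \<mu> u =
     (if obs_prob M k \<mu> u > 0
      then measure_of UNIV (sets borel)
             (\<lambda>C. emeasure (predict M u \<mu>) (C \<inter> obs M k) / ennreal (obs_prob M k \<mu> u))
      else rho M k)"


section \<open>Information states\<close>

type_synonym 'x info = "nat \<times> 'x measure"

definition weak_topology :: "'x::topological_space measure topology" where
  "weak_topology = topology_generated_by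
     {{\<mu> \<in> prob_measures. (\<integral>x. \<phi> x \<partial>\<mu>) \<in> W} | (\<phi> :: 'x \<Rightarrow> real) W.
        continuous_on UNIV \<phi> \<and> bounded (range \<phi>) \<and> open W}"

definition class_measures :: "('x::polish_space, 'u, 'e, 'v) pomdp \<Rightarrow> nat \<Rightarrow> 'x measure set" where
  "class_measures M j = {\<mu> \<in> prob_measures. measure \<mu> (obs M j) = 1}"

definition info_states :: "('x::polish_space, 'u, 'e, 'v) pomdp \<Rightarrow> 'x info set" where
  "info_states M = Sigma (classes M) (class_measures M)"

definition info_topology :: "('x::polish_space, 'u, 'e, 'v) pomdp \<Rightarrow> 'x info topology" where
  "info_topology M =
     sum_topology (\<lambda>j. subtopology weak_topology (class_measures M j)) (classes M)"

definition info_borel :: "('x::polish_space, 'u, 'e, 'v) pomdp \<Rightarrow> 'x info measure" where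
  "info_borel M = sigma (info_states M) {D. openin (info_topology M) D}"

lemma topspace_weak_topology: "topspace weak_topology = prob_measures"
proof -
  have "prob_measures \<in> {{\<mu> \<in> prob_measures. (\<integral>x. \<phi> x \<partial>\<mu>) \<in> W} | (\<phi> :: 'a \<Rightarrow> real) W.
        continuous_on UNIV \<phi> \<and> bounded (range \<phi>) \<and> open W}"
    by (intro CollectI exI[of _ "\<lambda>_. 0"] exI[of _ UNIV]) auto
  then show ?thesis
    unfolding weak_topology_def topology_generated_by_topspace by blast
qed

lemma topspace_info_topology: "topspace (info_topology M) = info_states M"
  by (auto simp: info_topology_def info_states_def class_measures_def topspace_weak_topology)

definition info_kernel ::
    "('x::polish_space, 'u, 'e, 'v) pomdp \<Rightarrow> 'x info \<Rightarrow> 'u \<Rightarrow> 'x info measure" where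
  "info_kernel M I u = measure_of (info_states M) (sets (info_borel M))
     (\<lambda>D. \<Sum>k\<in>classes M. ennreal (obs_prob M k (snd I) u) * indicator D (k, filter_upd M k (snd I) u))"

definition filt_cost :: "('x::polish_space, 'u, 'e, 'v) pomdp \<Rightarrow> 'x info \<Rightarrow> 'u \<Rightarrow> real" where
  "filt_cost M I u = (\<integral>x. cost M x u \<partial>snd I)"

definition lower_semicontinuous_map :: "'a topology \<Rightarrow> ('a \<Rightarrow> real) \<Rightarrow> bool" where
  "lower_semicontinuous_map T f \<longleftrightarrow> (\<forall>a. openin T {z \<in> topspace T. a < f z})"

definition weakly_continuous_kernel ::
    "('x::polish_space, 'u::polish_space, 'e, 'v) pomdp \<Rightarrow> bool" where
  "weakly_continuous_kernel M \<longleftrightarrow>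
     (\<forall>v. continuous_map (info_topology M) euclideanreal v \<and> bounded (v ` info_states M) \<longrightarrow>
        continuous_map (prod_topology (info_topology M) (euclidean :: 'u topology)) euclideanreal
          (\<lambda>(I, u). \<integral>I'. v I' \<partial>info_kernel M I u))"


section \<open>Policies and the control problem\<close>

text \<open>
  The trajectory coordinate at time \<open>t\<close> is the pair \<open>(I\<^sub>t, U\<^sub>t)\<close>. The information available at time \<open>t\<close>
  is \<open>(h, I\<^sub>t)\<close>, where \<open>h\<close> lists the pairs \<open>(I\<^sub>s, U\<^sub>s)\<close> with \<open>s < t\<close>.
\<close>

definition step_space :: "('x::polish_space, 'u::polish_space, 'e, 'v) pomdp \<Rightarrow> ('x info \<times> 'u) measure" where
  "step_space M = info_borel M \<Otimes>\<^sub>M borel"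

type_synonym ('x, 'u) policy = "nat \<Rightarrow> (nat \<Rightarrow> 'x info \<times> 'u) \<times> 'x info \<Rightarrow> 'u measure"

definition policies :: "('x::polish_space, 'u::polish_space, 'e, 'v) pomdp \<Rightarrow> ('x, 'u) policy set" where
  "policies M =
     {\<gamma>. \<forall>t. \<gamma> t \<in> PiM {0..<t} (\<lambda>_. step_space M) \<Otimes>\<^sub>M info_borel M \<rightarrow>\<^sub>M prob_algebra borel}"

text \<open>Conditional law of \<open>(I\<^sub>t, U\<^sub>t)\<close> given the past \<open>h\<close>, for the initial state \<open>I\<close>.\<close>

definition step_law :: "('x::polish_space, 'u::polish_space, 'e, 'v) pomdp \<Rightarrow> ('x, 'u) policy \<Rightarrow>
    'x info \<Rightarrow> nat \<Rightarrow> (nat \<Rightarrow> 'x info \<times> 'u) \<Rightarrow> ('x info \<times> 'u) measure" where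
  "step_law M \<gamma> I t h =
     (if t = 0 then return (info_borel M) I else info_kernel M (fst (h (t - 1))) (snd (h (t - 1)))) \<bind>
       (\<lambda>I'. \<gamma> t (h, I') \<bind> (\<lambda>u. return (step_space M) (I', u)))"

text \<open>Law of the whole trajectory, by the Ionescu-Tulcea construction.\<close>

definition traj_law :: "('x::polish_space, 'u::polish_space, 'e, 'v) pomdp \<Rightarrow> ('x, 'u) policy \<Rightarrow>
    'x info \<Rightarrow> (nat \<Rightarrow> 'x info \<times> 'u) measure" where
  "traj_law M \<gamma> I =
     projective_family.lim UNIV (Ionescu_Tulcea.CI (step_law M \<gamma> I) (\<lambda>_. step_space M))
       (\<lambda>_. step_space M)"

definition policy_cost ::
    "('x::polish_space, 'u::polish_space, 'e, 'v) pomdp \<Rightarrow> ('x, 'u) policy \<Rightarrow> 'x info \<Rightarrow> real" where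
  "policy_cost M \<gamma> I =
     (\<integral>\<omega>. (\<Sum>t. disc M ^ t * filt_cost M (fst (\<omega> t)) (snd (\<omega> t))) \<partial>traj_law M \<gamma> I)"

definition opt_value ::
    "('x::polish_space, 'u::polish_space, 'e, 'v) pomdp \<Rightarrow> 'x info \<Rightarrow> real" where
  "opt_value M I = (INF \<gamma>\<in>policies M. policy_cost M \<gamma> I)"

definition stationary :: "('x info \<Rightarrow> 'u::polish_space) \<Rightarrow> ('x, 'u) policy" where
  "stationary f t = (\<lambda>(h, I). return borel (f I))"

definition bounded_borel :: "('x::polish_space, 'u, 'e, 'v) pomdp \<Rightarrow> ('x info \<Rightarrow> real) set" where
  "bounded_borel M = {V \<in> borel_measurable (info_borel M). bounded (V ` info_states M)}"

definition bellman ::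
    "('x::polish_space, 'u, 'e, 'v) pomdp \<Rightarrow> ('x info \<Rightarrow> real) \<Rightarrow> 'x info \<Rightarrow> real" where
  "bellman M V I = (INF u. filt_cost M I u + disc M * (\<integral>I'. V I' \<partial>info_kernel M I u))"

end

theory Submission
  imports Defs
begin

text \<open>
  The argument is discounted dynamic programming carried out inside the class of bounded lower
  semicontinuous functions on the information states.

  For a function \<open>V\<close> of the information state let \<open>Q\<^sub>V(I, u) = g(I, u) + \<alpha> \<integral> V dK(\<cdot> | I, u)\<close>, so that the
  Bellman operator is \<open>(B V)(I) = inf\<^sub>u Q\<^sub>V(I, u)\<close>. If \<open>V\<close> is bounded and lower semicontinuous, then
  so is \<open>Q\<^sub>V\<close>: the cost is lower semicontinuous by hypothesis, and the integral of \<open>V\<close>, after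
  rescaling its values to \<open>[0, 1]\<close>, is a uniform limit of positive combinations of the probabilities \<open>K(V > t | I, u)\<close>, each of which is lower
  semicontinuous because weak continuity makes \<open>K(D | I, u)\<close> lower semicontinuous for every open
  \<open>D\<close> (\<open>lsc_integral\<close>, \<open>kernel_open_lsc\<close>). Since the action space is compact, minimising over \<open>u\<close> keeps
  lower semicontinuity (\<open>lsc_INF_compact\<close>), and the infimum is attained. As \<open>B\<close> contracts the sup
  norm by the factor \<open>\<alpha>\<close>, iterating it from \<open>0\<close> converges uniformly to a lower semicontinuous fixed
  point \<open>W\<close>, and there is no other bounded one (\<open>bellman_fixed_point\<close>, \<open>bellman_unique\<close>).

  The minimisers of \<open>Q\<^sub>W(I, \<cdot>)\<close> form a nonempty closed set that meets a given closed set \<open>C\<close> exactly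
  when the minimum over \<open>C\<close> does not exceed \<open>W(I)\<close>, a Borel condition on \<open>I\<close>. The selection
  theorem of Kuratowski and Ryll-Nardzewski then gives a Borel selector \<open>f\<close> (\<open>measurable_selection\<close>).

  Finally \<open>W\<close> is compared with the cost of a policy. Under any policy the law of the next state given
  the past is \<open>K(\<cdot> | I\<^sub>t, U\<^sub>t)\<close>, so a telescoping sum gives
  \<open>J\<^sub>\<gamma>(I) - W(I) = \<Sum>\<^sub>t \<alpha>\<^sup>t E[Q\<^sub>W(I\<^sub>t, U\<^sub>t) - W(I\<^sub>t)]\<close> (\<open>policy_cost_decomposition\<close>). All terms are
  nonnegative, and they vanish for the stationary policy given by \<open>f\<close>. Hence \<open>W\<close> is the optimal value.

  What makes the topological statements usable in measure theory is that the information states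
  carry a second countable topology induced by real-valued functions. The weak topology is the initial
  topology of a single sequence of functions \<open>\<mu> \<mapsto> \<integral> \<psi>\<^sub>m d\<mu>\<close>, so the space of information states is
  topologised by one map into the separable metric space \<open>real \<times> (nat \<Rightarrow> real)\<close>
  (\<open>weak_topology_pullback\<close>, \<open>info_topology_pullback\<close>). Consequently indicators of open sets are
  increasing limits of continuous functions, and open sets of state-action pairs belong to the product
  sigma-algebra.
\<close>

section \<open>Lower semicontinuous functions\<close>

lemma lsc_openin: "lower_semicontinuous_map T f \<Longrightarrow> openin T {z \<in> topspace T. a < f z}"
  by (simp add: lower_semicontinuous_map_def)

lemma lsc_cong:
  assumes "\<And>z. z \<in> topspace T \<Longrightarrow> f z = g z"
  shows "lower_semicontinuous_map T f \<longleftrightarrow> lower_semicontinuous_map T g"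
proof -
  have "{z \<in> topspace T. a < f z} = {z \<in> topspace T. a < g z}" for a using assms by auto
  then show ?thesis by (simp add: lower_semicontinuous_map_def)
qed

lemma continuous_imp_lsc: "continuous_map T euclideanreal f \<Longrightarrow> lower_semicontinuous_map T f"
  by (simp add: lower_semicontinuous_map_def continuous_map_upper_lower_semicontinuous_lt)

lemma continuous_iff_lsc:
  "continuous_map T euclideanreal f \<longleftrightarrow>
     lower_semicontinuous_map T f \<and> lower_semicontinuous_map T (\<lambda>z. - f z)"
proof -
  have "(\<forall>a. openin T {z \<in> topspace T. f z < a}) \<longleftrightarrow> (\<forall>a. openin T {z \<in> topspace T. a < - f z})"
    by (metis (no_types, lifting) Collect_cong minus_less_iff minus_minus)
  then show ?thesis
    by (simp add: lower_semicontinuous_map_def continuous_map_upper_lower_semicontinuous_lt)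
qed

lemma lsc_add:
  assumes f: "lower_semicontinuous_map T f" and g: "lower_semicontinuous_map T g"
  shows "lower_semicontinuous_map T (\<lambda>z. f z + g z)"
  unfolding lower_semicontinuous_map_def
proof
  fix a
  have "{z \<in> topspace T. a < f z + g z} =
      (\<Union>q. {z \<in> topspace T. q < f z} \<inter> {z \<in> topspace T. a - q < g z})" (is "?L = ?R")
  proof (intro equalityI subsetI)
    fix z assume z: "z \<in> ?L"
    then have "f z - (f z + g z - a) / 2 < f z" "a - (f z - (f z + g z - a) / 2) < g z"
      by (auto simp: field_simps)
    with z show "z \<in> ?R" by blast
  next
    fix z assume "z \<in> ?R"
    then obtain q where "z \<in> topspace T" "q < f z" "a - q < g z" by blast
    then show "z \<in> ?L" by auto
  qed
  then show "openin T {z \<in> topspace T. a < f z + g z}"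
    by (auto intro!: openin_Union openin_Int lsc_openin[OF f] lsc_openin[OF g])
qed

lemma lsc_const: "lower_semicontinuous_map T (\<lambda>_. c)"
  by (intro continuous_imp_lsc) simp

lemma lsc_scale:
  assumes c: "0 \<le> c" and f: "lower_semicontinuous_map T f"
  shows "lower_semicontinuous_map T (\<lambda>z. c * f z)"
proof (cases "c = 0")
  case False
  with c have "{z \<in> topspace T. a < c * f z} = {z \<in> topspace T. a / c < f z}" for a
    by (auto simp: field_simps)
  then show ?thesis using f by (simp add: lower_semicontinuous_map_def)
qed (simp add: lsc_const)

lemma lsc_sum:
  assumes "\<And>i. i \<in> A \<Longrightarrow> lower_semicontinuous_map T (f i)"
  shows "lower_semicontinuous_map T (\<lambda>z. \<Sum>i\<in>A. f i z)"
  using assms by (induction A rule: infinite_finite_induct) (auto intro: lsc_const lsc_add)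

lemma lsc_increasing_limit:
  assumes f: "\<And>n. lower_semicontinuous_map T (f n)"
    and inc: "\<And>z. z \<in> topspace T \<Longrightarrow> incseq (\<lambda>n. f n z)"
    and lim: "\<And>z. z \<in> topspace T \<Longrightarrow> (\<lambda>n. f n z) \<longlonglongrightarrow> g z"
  shows "lower_semicontinuous_map T g"
  unfolding lower_semicontinuous_map_def
proof
  fix a
  have "{z \<in> topspace T. a < g z} = (\<Union>n. {z \<in> topspace T. a < f n z})"
  proof (intro equalityI subsetI)
    fix z assume "z \<in> {z \<in> topspace T. a < g z}"
    then have z: "z \<in> topspace T" "a < g z" by auto
    from order_tendstoD(1)[OF lim[OF z(1)] z(2)] obtain n where "a < f n z"
      by (auto simp: eventually_sequentially)
    with z show "z \<in> (\<Union>n. {z \<in> topspace T. a < f n z})" by blast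
  next
    fix z assume "z \<in> (\<Union>n. {z \<in> topspace T. a < f n z})"
    then obtain n where z: "z \<in> topspace T" "a < f n z" by blast
    from incseq_le[OF inc lim, OF z(1) z(1), of n] z show "z \<in> {z \<in> topspace T. a < g z}" by auto
  qed
  then show "openin T {z \<in> topspace T. a < g z}"
    by (auto intro!: openin_Union lsc_openin[OF f])
qed

lemma lsc_uniform_limit:
  assumes "\<And>e. e > 0 \<Longrightarrow>
    \<exists>f. lower_semicontinuous_map T f \<and> (\<forall>z\<in>topspace T. \<bar>f z - g z\<bar> \<le> (e::real))"
  shows "lower_semicontinuous_map T g"
  unfolding lower_semicontinuous_map_def
proof
  fix a
  show "openin T {z \<in> topspace T. a < g z}"
  proof (subst openin_subopen, intro ballI)
    fix z assume "z \<in> {z \<in> topspace T. a < g z}"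
    then have z: "z \<in> topspace T" "a < g z" by auto
    define e where "e = (g z - a) / 3"
    have e: "e > 0" using z by (simp add: e_def)
    obtain f where f: "lower_semicontinuous_map T f" "\<forall>z\<in>topspace T. \<bar>f z - g z\<bar> \<le> e"
      using assms[OF e] by blast
    have "\<bar>f z - g z\<bar> \<le> e" "3 * e = g z - a" using f(2) z by (auto simp: e_def)
    with e have "a + e < f z" by linarith
    moreover have "a < g y" if "y \<in> topspace T" "a + e < f y" for y
      using f(2)[rule_format, OF that(1)] that(2) by linarith
    ultimately show "\<exists>U. openin T U \<and> z \<in> U \<and> U \<subseteq> {z \<in> topspace T. a < g z}"
      using lsc_openin[OF f(1), of "a + e"] z
      by (intro exI[of _ "{z \<in> topspace T. a + e < f z}"]) auto
  qed
qed

text \<open>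
  If no point were minimal, the open sets \<open>{u. F w < F u}\<close> would cover \<open>C\<close>; in a finite subcover the
  smallest of the values \<open>F w\<close> would then have to be undercut by another one of them.
\<close>

lemma lsc_attains_min_on_compact:
  fixes F :: "'u::topological_space \<Rightarrow> real"
  assumes F: "lower_semicontinuous_map euclidean F" and C: "compact C" "C \<noteq> {}"
  obtains u where "u \<in> C" "\<And>w. w \<in> C \<Longrightarrow> F u \<le> F w"
proof -
  have "\<exists>u\<in>C. \<forall>w\<in>C. F u \<le> F w"
  proof (rule ccontr)
    assume "\<not> ?thesis"
    then have *: "\<And>u. u \<in> C \<Longrightarrow> \<exists>w\<in>C. F w < F u" by (auto simp: not_le)
    have op: "open {u. F w < F u}" for w using lsc_openin[OF F, of "F w"] by simp
    have "C \<subseteq> (\<Union>w\<in>C. {u. F w < F u})" using * by auto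
    from compactE_image[OF C(1) op this] obtain D where
      D: "D \<subseteq> C" "finite D" "C \<subseteq> (\<Union>w\<in>D. {u. F w < F u})" by metis
    then have ne: "D \<noteq> {}" using C(2) by auto
    have "Min (F ` D) \<in> F ` D" using D ne by (intro Min_in) auto
    then obtain w where w: "w \<in> D" "F w = Min (F ` D)" by auto
    with D obtain w' where "w' \<in> D" "F w' < F w" by blast
    moreover have "F w \<le> F w'" using w D \<open>w' \<in> D\<close> by (simp add: Min_le)
    ultimately show False by simp
  qed
  then show ?thesis using that by blast
qed

lemma lsc_section:
  assumes F: "lower_semicontinuous_map (prod_topology T U) (\<lambda>(z, u). F z u)" and z: "z \<in> topspace T"
  shows "lower_semicontinuous_map U (F z)"
  unfolding lower_semicontinuous_map_def
proof
  fix a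
  have "continuous_map U (prod_topology T U) (\<lambda>u. (z, u))"
    using z by (simp add: continuous_map_pairwise o_def)
  from openin_continuous_map_preimage[OF this lsc_openin[OF F, of a]] z
  show "openin U {u \<in> topspace U. a < F z u}" by simp
qed

text \<open>
  Because the minimum over \<open>C\<close> is attained, it fails to exceed \<open>a\<close> exactly on the projection of the closed
  set \<open>{(z, u). u \<in> C \<and> F z u \<le> a}\<close>, and projecting along a compact factor is a closed map.
\<close>

lemma lsc_INF_compact:
  fixes F :: "'i \<Rightarrow> 'u::t2_space \<Rightarrow> real"
  assumes F: "lower_semicontinuous_map (prod_topology T euclidean) (\<lambda>(z, u). F z u)"
    and U: "compact (UNIV :: 'u set)" and C: "closed C" "C \<noteq> {}"
  shows "lower_semicontinuous_map T (\<lambda>z. INF u\<in>C. F z u)"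
  unfolding lower_semicontinuous_map_def
proof
  fix a
  have cC: "compact C" using compact_Int_closed[OF U C(1)] by simp
  let ?A = "{p \<in> topspace (prod_topology T euclidean). a < (case p of (z, u) \<Rightarrow> F z u)}"
  have cl: "closedin (prod_topology T euclidean)
      ((topspace (prod_topology T euclidean) - ?A) \<inter> (topspace T \<times> C))"
    using lsc_openin[OF F, of a] C by (intro closedin_Int closedin_diff) (auto simp: closedin_prod_Times_iff)
  have "closed_map (prod_topology T (euclidean :: 'u topology)) T fst"
    using U by (intro Abstract_Topological_Spaces.closed_map_fst) (simp add: compact_space_def)
  from this[unfolded closed_map_def, rule_format, OF cl]
  have "openin T (topspace T - fst ` ((topspace (prod_topology T euclidean) - ?A) \<inter> (topspace T \<times> C)))"
    by (rule openin_diff[OF openin_topspace])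
  also have "topspace T - fst ` ((topspace (prod_topology T euclidean) - ?A) \<inter> (topspace T \<times> C)) =
      {z \<in> topspace T. a < (INF u\<in>C. F z u)}" (is "?L = ?R")
  proof -
    have "(\<forall>u\<in>C. a < F z u) \<longleftrightarrow> a < (INF u\<in>C. F z u)" if z: "z \<in> topspace T" for z
    proof -
      obtain u where u: "u \<in> C" "\<And>w. w \<in> C \<Longrightarrow> F z u \<le> F z w"
        using lsc_attains_min_on_compact[OF lsc_section[OF F z] cC C(2)] by blast
      have "(INF u\<in>C. F z u) = F z u"
        using u by (intro cInf_eq_minimum) auto
      with u show ?thesis by force
    qed
    moreover have "?L = {z \<in> topspace T. \<forall>u\<in>C. a < F z u}" by (force simp: image_iff)
    ultimately show ?thesis by auto
  qed
  finally show "openin T {z \<in> topspace T. a < (INF u\<in>C. F z u)}" .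
qed

section \<open>Integrals with respect to a varying probability measure\<close>

lemma staircase_bounds:
  fixes y :: real
  assumes y: "0 \<le> y" "y \<le> 1" and n: "n > 0"
  defines "s \<equiv> (\<Sum>i\<in>{1..n}. if real i / n < y then 1 else 0) / real n"
  shows "s \<le> y" "y \<le> s + 1 / n"
proof -
  define m where "m = nat \<lceil>n * y\<rceil>"
  have ny: "real n * y \<le> real n * 1" using y by (intro mult_left_mono) auto
  then have mn: "m \<le> n" unfolding m_def by linarith
  have iff: "real i / n < y \<longleftrightarrow> i < m" for i
  proof -
    have "real i / n < y \<longleftrightarrow> real i < n * y" using n by (simp add: field_simps)
    also have "\<dots> \<longleftrightarrow> i < m" unfolding m_def by linarith
    finally show ?thesis .
  qed
  have "(\<Sum>i\<in>{1..n}. if real i / n < y then 1 else 0 :: real) = (\<Sum>i\<in>{1..<m}. 1)"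
    using mn by (intro sum.mono_neutral_cong_right) (auto simp: iff)
  then have s: "s = real (m - 1) / n" by (simp add: s_def)
  have "real (m - 1) \<le> n * y" "n * y \<le> real (m - 1) + 1"
    using y n mult_nonneg_nonneg[of "real n" y] unfolding m_def by linarith+
  then show "s \<le> y" "y \<le> s + 1 / n" using n by (auto simp: s field_simps)
qed

text \<open>
  Approximating \<open>V\<close> from below by the staircase \<open>(1 / n) * (\<Sum>i = 1..n. indicator {V > i / n})\<close> costs at most
  \<open>1 / n\<close>, whatever the measure is. The integral is thus a uniform limit of positive combinations of the
  probabilities of superlevel sets.
\<close>

lemma lsc_integral_unit:
  fixes V :: "'a \<Rightarrow> real" and \<kappa> :: "'z \<Rightarrow> 'a measure"
  assumes prob: "\<And>z. z \<in> topspace T \<Longrightarrow> prob_space (\<kappa> z)"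
    and meas: "\<And>z. z \<in> topspace T \<Longrightarrow> V \<in> borel_measurable (\<kappa> z)"
    and unit: "\<And>z x. z \<in> topspace T \<Longrightarrow> x \<in> space (\<kappa> z) \<Longrightarrow> 0 \<le> V x \<and> V x \<le> 1"
    and lsc: "\<And>t. lower_semicontinuous_map T (\<lambda>z. measure (\<kappa> z) {x \<in> space (\<kappa> z). t < V x})"
  shows "lower_semicontinuous_map T (\<lambda>z. \<integral>x. V x \<partial>\<kappa> z)"
proof (rule lsc_uniform_limit)
  fix e :: real assume "e > 0"
  then obtain n0 :: nat where "inverse (real (Suc n0)) < e" using reals_Archimedean by blast
  then obtain n :: nat where n: "n > 0" "1 / n < e" by (metis inverse_eq_divide zero_less_Suc)
  let ?S = "\<lambda>z. \<Sum>i\<in>{1..n}. (1 / n) * measure (\<kappa> z) {x \<in> space (\<kappa> z). real i / n < V x}"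
  have "\<bar>?S z - (\<integral>x. V x \<partial>\<kappa> z)\<bar> \<le> e" if z: "z \<in> topspace T" for z
  proof -
    interpret prob_space "\<kappa> z" using prob[OF z] .
    note meas[OF z, measurable]
    let ?s = "\<lambda>x. (\<Sum>i\<in>{1..n}. if real i / n < V x then 1 else 0) / real n"
    have [measurable]: "?s \<in> borel_measurable (\<kappa> z)" by measurable
    have iV: "integrable (\<kappa> z) V"
      using unit[OF z] by (intro integrable_const_bound[of _ 1]) auto
    have is_int: "integrable (\<kappa> z) ?s"
      by (intro integrable_divide Bochner_Integration.integrable_sum integrable_const_bound[of _ 1]) auto
    have "(\<integral>x. ?s x \<partial>\<kappa> z) = (\<integral>x. (\<Sum>i\<in>{1..n}. (1 / n) * indicator {x \<in> space (\<kappa> z). real i / n < V x} x) \<partial>\<kappa> z)"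
      by (intro Bochner_Integration.integral_cong) (auto simp: sum_divide_distrib indicator_def intro!: sum.cong)
    also have "\<dots> = ?S z"
      by (subst Bochner_Integration.integral_sum)
        (auto intro!: integrable_divide integrable_real_indicator simp: emeasure_eq_measure)
    finally have S: "(\<integral>x. ?s x \<partial>\<kappa> z) = ?S z" .
    have "(\<integral>x. ?s x \<partial>\<kappa> z) \<le> (\<integral>x. V x \<partial>\<kappa> z)"
      using staircase_bounds(1)[OF _ _ n(1)] unit[OF z] by (intro integral_mono is_int iV) auto
    moreover have "(\<integral>x. V x \<partial>\<kappa> z) \<le> (\<integral>x. ?s x + 1 / n \<partial>\<kappa> z)"
      using staircase_bounds(2)[OF _ _ n(1)] unit[OF z]
      by (intro integral_mono Bochner_Integration.integrable_add is_int iV) auto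
    moreover have "(\<integral>x. ?s x + 1 / n \<partial>\<kappa> z) = (\<integral>x. ?s x \<partial>\<kappa> z) + 1 / n"
      using is_int by (subst Bochner_Integration.integral_add) (auto simp: prob_space)
    ultimately show ?thesis using n S by linarith
  qed
  moreover have "lower_semicontinuous_map T ?S"
    by (intro lsc_sum lsc_scale lsc) auto
  ultimately show "\<exists>f. lower_semicontinuous_map T f \<and> (\<forall>z\<in>topspace T. \<bar>f z - (\<integral>x. V x \<partial>\<kappa> z)\<bar> \<le> e)"
    by blast
qed

lemma lsc_integral:
  fixes V :: "'a \<Rightarrow> real" and \<kappa> :: "'z \<Rightarrow> 'a measure"
  assumes prob: "\<And>z. z \<in> topspace T \<Longrightarrow> prob_space (\<kappa> z)"
    and meas: "\<And>z. z \<in> topspace T \<Longrightarrow> V \<in> borel_measurable (\<kappa> z)"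
    and bound: "\<And>z x. z \<in> topspace T \<Longrightarrow> x \<in> space (\<kappa> z) \<Longrightarrow> \<bar>V x\<bar> \<le> b"
    and lsc: "\<And>t. lower_semicontinuous_map T (\<lambda>z. measure (\<kappa> z) {x \<in> space (\<kappa> z). t < V x})"
  shows "lower_semicontinuous_map T (\<lambda>z. \<integral>x. V x \<partial>\<kappa> z)"
proof -
  define c where "c = 2 * (\<bar>b\<bar> + 1)"
  have c: "c > 0" by (simp add: c_def)
  let ?V = "\<lambda>x. (V x + c / 2) / c"
  have bound': "- c / 2 \<le> V x \<and> V x \<le> c / 2" if "z \<in> topspace T" "x \<in> space (\<kappa> z)" for z x
    using bound[OF that] by (auto simp: c_def)
  have "lower_semicontinuous_map T (\<lambda>z. \<integral>x. ?V x \<partial>\<kappa> z)"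
  proof (rule lsc_integral_unit)
    fix t
    have "t < ?V x \<longleftrightarrow> c * t - c / 2 < V x" for x using c by (simp add: field_simps)
    then show "lower_semicontinuous_map T (\<lambda>z. measure (\<kappa> z) {x \<in> space (\<kappa> z). t < ?V x})"
      using lsc[of "c * t - c / 2"] by simp
  next
    fix z x assume "z \<in> topspace T" "x \<in> space (\<kappa> z)"
    from bound'[OF this] c show "0 \<le> ?V x \<and> ?V x \<le> 1" by (simp add: field_simps)
  next
    fix z assume "z \<in> topspace T"
    note meas[OF this, measurable]
    show "?V \<in> borel_measurable (\<kappa> z)" by measurable
  qed (rule prob)
  then have "lower_semicontinuous_map T (\<lambda>z. c * (\<integral>x. ?V x \<partial>\<kappa> z) + (- c / 2))"
    using c by (intro lsc_add lsc_scale lsc_const) auto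
  also have "?this \<longleftrightarrow> ?thesis"
  proof (rule lsc_cong)
    fix z assume z: "z \<in> topspace T"
    interpret prob_space "\<kappa> z" using prob[OF z] .
    have "integrable (\<kappa> z) V"
      using meas[OF z] bound[OF z] by (intro integrable_const_bound[of _ b]) auto
    then show "c * (\<integral>x. ?V x \<partial>\<kappa> z) + (- c / 2) = (\<integral>x. V x \<partial>\<kappa> z)"
      using c by (simp add: prob_space field_simps)
  qed
  finally show ?thesis .
qed

text \<open>
  The easy half of the portmanteau theorem: \<open>D\<close> is approximated from inside by functions whose
  integrals are already known to depend lower semicontinuously on the measure.
\<close>

lemma lsc_measure_open:
  fixes \<kappa> :: "'z \<Rightarrow> 'a measure" and f :: "nat \<Rightarrow> 'a \<Rightarrow> real"
  assumes prob: "\<And>z. z \<in> topspace T \<Longrightarrow> prob_space (\<kappa> z)"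
    and meas: "\<And>z n. z \<in> topspace T \<Longrightarrow> f n \<in> borel_measurable (\<kappa> z)"
    and D: "\<And>z. z \<in> topspace T \<Longrightarrow> D \<in> sets (\<kappa> z)"
    and unit: "\<And>z n x. z \<in> topspace T \<Longrightarrow> x \<in> space (\<kappa> z) \<Longrightarrow> 0 \<le> f n x \<and> f n x \<le> 1"
    and inc: "\<And>z x. z \<in> topspace T \<Longrightarrow> x \<in> space (\<kappa> z) \<Longrightarrow> incseq (\<lambda>n. f n x)"
    and lim: "\<And>z x. z \<in> topspace T \<Longrightarrow> x \<in> space (\<kappa> z) \<Longrightarrow> (\<lambda>n. f n x) \<longlonglongrightarrow> indicator D x"
    and lsc: "\<And>n. lower_semicontinuous_map T (\<lambda>z. \<integral>x. f n x \<partial>\<kappa> z)"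
  shows "lower_semicontinuous_map T (\<lambda>z. measure (\<kappa> z) D)"
proof (rule lsc_increasing_limit[OF lsc])
  fix z assume z: "z \<in> topspace T"
  interpret prob_space "\<kappa> z" using prob[OF z] .
  note [measurable] = meas[OF z] D[OF z]
  have i: "integrable (\<kappa> z) (f n)" for n
    using unit[OF z] by (intro integrable_const_bound[of _ 1]) auto
  show "incseq (\<lambda>n. \<integral>x. f n x \<partial>\<kappa> z)"
    using inc[OF z] by (auto intro!: incseq_SucI integral_mono i dest: incseq_SucD)
  have "(\<lambda>n. \<integral>x. f n x \<partial>\<kappa> z) \<longlonglongrightarrow> (\<integral>x. indicator D x \<partial>\<kappa> z)"
    using unit[OF z] lim[OF z]
    by (intro integral_dominated_convergence[where w="\<lambda>_. 1"]) auto
  then show "(\<lambda>n. \<integral>x. f n x \<partial>\<kappa> z) \<longlonglongrightarrow> measure (\<kappa> z) D"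
    using D[OF z] by simp
qed

section \<open>Topologies induced by a map into a separable metric space\<close>

text \<open>
  A single countable family of continuous functions approximates the indicators of all open sets from
  below. It consists of the truncated sums \<open>min 1 (N * (h k\<^sub>1 + \<dots> + h k\<^sub>r))\<close>, where \<open>h k\<close> is positive
  exactly on the \<open>k\<close>-th member of a countable base; for an open set \<open>G\<close> one lets \<open>N\<close> grow together
  with the list of base members inside \<open>G\<close>.
\<close>

lemma countable_urysohn_family:
  obtains \<psi> :: "nat \<Rightarrow> 'b::{metric_space, second_countable_topology} \<Rightarrow> real"
  where "\<And>m. continuous_on UNIV (\<psi> m)" "\<And>m x. 0 \<le> \<psi> m x" "\<And>m x. \<psi> m x \<le> 1"
    "\<And>G. open G \<Longrightarrow> \<exists>s. \<forall>x. incseq (\<lambda>n. \<psi> (s n) x) \<and> (\<lambda>n. \<psi> (s n) x) \<longlonglongrightarrow> indicator G x"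
proof -
  obtain \<B> :: "'b set set" where \<B>: "countable \<B>" "topological_basis \<B>"
    using ex_countable_basis by blast
  have ne: "\<B> \<noteq> {}" using topological_basisE[OF \<B>(2) open_UNIV, of undefined] by blast
  define B where "B = from_nat_into \<B>"
  have B_open: "open (B k)" for k
    unfolding B_def by (rule topological_basis_open[OF \<B>(2) from_nat_into[OF ne]])
  have B_ex: "\<exists>k. x \<in> B k \<and> B k \<subseteq> G" if G: "open G" "x \<in> G" for G x
  proof -
    obtain W where W: "W \<in> \<B>" "x \<in> W" "W \<subseteq> G" using topological_basisE[OF \<B>(2) G] by blast
    moreover obtain k where "from_nat_into \<B> k = W" using from_nat_into_surj[OF \<B>(1) W(1)] by blast
    ultimately show ?thesis unfolding B_def by blast
  qed
  \<comment> \<open>The distance to the empty set is \<open>0\<close> by convention, so the base member \<open>UNIV\<close> needs its own value.\<close>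
  define h where "h k x = (if B k = UNIV then 1 else infdist x (- B k))" for k and x :: 'b
  have h_cont: "continuous_on UNIV (h k)" for k
    by (cases "B k = UNIV") (auto simp: h_def intro!: continuous_intros)
  have h_nonneg: "0 \<le> h k x" for k x by (simp add: h_def infdist_nonneg)
  have h_pos: "0 < h k x \<longleftrightarrow> x \<in> B k" for k x
  proof (cases "B k = UNIV")
    case False
    then have "- B k \<noteq> {}" by auto
    then have "x \<in> - B k \<longleftrightarrow> infdist x (- B k) = 0"
      using B_open[of k] by (intro in_closed_iff_infdist_zero) auto
    with False show ?thesis using h_nonneg[of k x] by (auto simp: h_def less_le)
  qed (simp add: h_def)
  define \<phi> where "\<phi> N ks x = min 1 (real N * (\<Sum>k\<leftarrow>ks. h k x))" for N ks and x :: 'b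
  define \<psi> where "\<psi> m = (case (from_nat m :: nat \<times> nat list) of (N, ks) \<Rightarrow> \<phi> N ks)" for m
  have sum_nonneg: "0 \<le> (\<Sum>k\<leftarrow>ks. h k x)" for ks x
    by (intro sum_list_nonneg) (auto simp: h_nonneg)
  have sum_cont: "continuous_on UNIV (\<lambda>x. \<Sum>k\<leftarrow>ks. h k x)" for ks
    by (induction ks) (auto intro!: continuous_intros h_cont)
  show ?thesis
  proof
    show "continuous_on UNIV (\<psi> m)" for m
      unfolding \<psi>_def \<phi>_def[abs_def] by (auto split: prod.split intro!: continuous_intros sum_cont)
    show "0 \<le> \<psi> m x" "\<psi> m x \<le> 1" for m x
      unfolding \<psi>_def \<phi>_def by (auto split: prod.split simp: sum_nonneg)
    fix G :: "'b set" assume G: "open G"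
    define ks where "ks n = filter (\<lambda>k. B k \<subseteq> G) [0..<n]" for n
    define s where "s n = to_nat (n, ks n)" for n
    have s: "\<psi> (s n) x = \<phi> n (ks n) x" for n x by (simp add: \<psi>_def s_def)
    have ks_Suc: "(\<Sum>k\<leftarrow>ks n. h k x) \<le> (\<Sum>k\<leftarrow>ks (Suc n). h k x)" for n x
      by (auto simp: ks_def h_nonneg)
    have inc: "incseq (\<lambda>n. \<phi> n (ks n) x)" for x
      unfolding \<phi>_def by (intro incseq_SucI min.mono mult_mono ks_Suc sum_nonneg) auto
    have "(\<lambda>n. \<phi> n (ks n) x) \<longlonglongrightarrow> indicator G x" for x
    proof (cases "x \<in> G")
      case True
      from B_ex[OF G True] obtain k where k: "x \<in> B k" "B k \<subseteq> G" by blast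
      have hk: "h k x > 0" using k h_pos by blast
      obtain N :: nat where N: "1 < real N * h k x" using reals_Archimedean3[OF hk] by blast
      have "\<phi> n (ks n) x = 1" if n: "n \<ge> N + Suc k" for n
      proof -
        have "k \<in> set (ks n)" using n k by (auto simp: ks_def)
        then have "h k x \<le> (\<Sum>k\<leftarrow>ks n. h k x)"
          by (intro member_le_sum_list) (auto simp: h_nonneg)
        then have "real N * h k x \<le> real n * (\<Sum>k\<leftarrow>ks n. h k x)"
          using n by (intro mult_mono) (auto simp: h_nonneg)
        with N show ?thesis by (simp add: \<phi>_def)
      qed
      then have "eventually (\<lambda>n. \<phi> n (ks n) x = 1) sequentially"
        unfolding eventually_sequentially by blast
      then show ?thesis using True by (simp add: tendsto_eventually)
    next
      case False
      have h0: "h k x = 0" if "B k \<subseteq> G" for k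
        using h_pos[of k x] h_nonneg[of k x] that False by auto
      then have "(\<Sum>k\<leftarrow>ks n. h k x) = 0" for n
        unfolding ks_def by (induction n) (auto simp: h0)
      then show ?thesis using False by (simp add: \<phi>_def)
    qed
    with inc show "\<exists>s. \<forall>x. incseq (\<lambda>n. \<psi> (s n) x) \<and> (\<lambda>n. \<psi> (s n) x) \<longlonglongrightarrow> indicator G x"
      by (intro exI[of _ s]) (auto simp: s)
  qed
qed

lemma openin_pullback_euclidean:
  "openin (pullback_topology S \<Theta> euclidean) D \<longleftrightarrow> (\<exists>W. open W \<and> D = \<Theta> -` W \<inter> S)"
  by (simp add: openin_pullback_topology)

lemma topspace_pullback_euclidean: "topspace (pullback_topology S \<Theta> euclidean) = S"
  by (simp add: topspace_pullback_topology)

lemma continuous_map_pullback_euclidean: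
  fixes w :: "'b::topological_space \<Rightarrow> 'c::topological_space"
  assumes "continuous_on UNIV w"
  shows "continuous_map (pullback_topology S \<Theta> euclidean) euclidean (\<lambda>x. w (\<Theta> x))"
proof -
  have "continuous_map euclidean euclidean w" using assms by simp
  from continuous_map_pullback[OF this, of S \<Theta>] show ?thesis by (simp only: o_def)
qed

lemma lsc_borel_measurable:
  assumes "lower_semicontinuous_map T v" "space N = topspace T" "\<And>D. openin T D \<Longrightarrow> D \<in> sets N"
  shows "v \<in> borel_measurable N"
  using assms by (simp add: borel_measurable_iff_greater lower_semicontinuous_map_def)

text \<open>
  An open set of the induced topology is the preimage of an open set of the metric space, so a family of
  measures that is continuous in the weak sense gives it a lower semicontinuous measure.
\<close>

lemma lsc_measure_open_pullback:
  fixes \<Theta> :: "'a \<Rightarrow> 'b::{metric_space, second_countable_topology}" and S :: "'a set" and \<kappa> :: "'z \<Rightarrow> 'a measure"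
  defines "T \<equiv> pullback_topology S \<Theta> euclidean"
  assumes prob: "\<And>z. z \<in> topspace Z \<Longrightarrow> prob_space (\<kappa> z)"
    and space: "\<And>z. z \<in> topspace Z \<Longrightarrow> space (\<kappa> z) = S"
    and opens: "\<And>z D. z \<in> topspace Z \<Longrightarrow> openin T D \<Longrightarrow> D \<in> sets (\<kappa> z)"
    and cont: "\<And>v. continuous_map T euclideanreal v \<Longrightarrow> bounded (v ` S) \<Longrightarrow>
      continuous_map Z euclideanreal (\<lambda>z. \<integral>x. v x \<partial>\<kappa> z)"
    and D: "openin T D"
  shows "lower_semicontinuous_map Z (\<lambda>z. measure (\<kappa> z) D)"
proof -
  have tT: "topspace T = S" by (simp add: T_def topspace_pullback_euclidean)
  obtain W where W: "open W" "D = \<Theta> -` W \<inter> S"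
    using D unfolding T_def openin_pullback_euclidean by blast
  obtain \<psi> :: "nat \<Rightarrow> 'b \<Rightarrow> real" where \<psi>: "\<And>m. continuous_on UNIV (\<psi> m)" "\<And>m x. 0 \<le> \<psi> m x" "\<And>m x. \<psi> m x \<le> 1"
    "\<And>G. open G \<Longrightarrow> \<exists>s. \<forall>x. incseq (\<lambda>n. \<psi> (s n) x) \<and> (\<lambda>n. \<psi> (s n) x) \<longlonglongrightarrow> indicator G x"
    using countable_urysohn_family by blast
  obtain s where s: "\<And>x. incseq (\<lambda>n. \<psi> (s n) x)" "\<And>x. (\<lambda>n. \<psi> (s n) x) \<longlonglongrightarrow> indicator W x"
    using \<psi>(4)[OF W(1)] by blast
  have c: "continuous_map T euclideanreal (\<lambda>x. \<psi> m (\<Theta> x))" for m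
    unfolding T_def by (rule continuous_map_pullback_euclidean[OF \<psi>(1)])
  show ?thesis
  proof (rule lsc_measure_open[where f="\<lambda>n x. \<psi> (s n) (\<Theta> x)"])
    fix z n assume z: "z \<in> topspace Z"
    show "(\<lambda>x. \<psi> (s n) (\<Theta> x)) \<in> borel_measurable (\<kappa> z)"
      using space[OF z] opens[OF z] tT by (intro lsc_borel_measurable[OF continuous_imp_lsc[OF c]]) auto
  next
    fix n
    have "bounded ((\<lambda>x. \<psi> (s n) (\<Theta> x)) ` S)"
      using \<psi>(2,3) by (intro boundedI[of _ 1]) auto
    then show "lower_semicontinuous_map Z (\<lambda>z. \<integral>x. \<psi> (s n) (\<Theta> x) \<partial>\<kappa> z)"
      by (intro continuous_imp_lsc cont c)
  next
    fix z x assume z: "z \<in> topspace Z" "x \<in> space (\<kappa> z)"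
    then show "(\<lambda>n. \<psi> (s n) (\<Theta> x)) \<longlonglongrightarrow> indicator D x"
      using s(2)[of "\<Theta> x"] space[OF z(1)] W(2) by (simp add: indicator_def)
  qed (use prob opens D \<psi> s in auto)
qed

text \<open>
  On a product of non-second-countable spaces an open set need not lie in the product sigma-algebra.
  Here it does, since it is the preimage of an open set in the product of two second countable types.
\<close>

lemma open_prod_pullback_measurable:
  fixes \<Theta> :: "'a \<Rightarrow> 'b::second_countable_topology" and S :: "'a set"
  defines "T \<equiv> pullback_topology S \<Theta> euclidean"
  assumes D: "openin (prod_topology T (euclidean :: 'u::second_countable_topology topology)) D"
  shows "D \<in> sets (sigma S {D. openin T D} \<Otimes>\<^sub>M borel)"
proof -
  have tT: "topspace T = S" by (simp add: T_def topspace_pullback_euclidean)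
  have sub: "{D. openin T D} \<subseteq> Pow S" using openin_subset tT by fastforce
  let ?N = "sigma S {D. openin T D}"
  have spN: "space ?N = S" using sub by (rule space_measure_of)
  have "\<Theta> \<in> measurable ?N borel"
  proof (rule borel_measurableI)
    fix W :: "'b set" assume "open W"
    then have "openin T (\<Theta> -` W \<inter> S)" unfolding T_def openin_pullback_euclidean by blast
    then show "\<Theta> -` W \<inter> space ?N \<in> sets ?N" using sub by (simp add: spN)
  qed
  then have m: "(\<lambda>p. (\<Theta> (fst p), snd p)) \<in> measurable (?N \<Otimes>\<^sub>M (borel :: 'u measure)) borel"
    unfolding borel_prod[symmetric] by measurable
  define W where "W = \<Union>{A \<times> B | A B. open A \<and> open B \<and> (\<Theta> -` A \<inter> S) \<times> B \<subseteq> D}"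
  have "open W" unfolding W_def by (intro open_Union) (auto intro: open_Times)
  have DS: "D \<subseteq> S \<times> UNIV" using openin_subset[OF D] tT by simp
  have "D = (\<lambda>p. (\<Theta> (fst p), snd p)) -` W \<inter> (S \<times> UNIV)"
  proof (intro equalityI subsetI)
    fix p assume p: "p \<in> D"
    then have "(fst p, snd p) \<in> D" by simp
    then have "\<exists>A B. openin T A \<and> openin euclidean B \<and> fst p \<in> A \<and> snd p \<in> B \<and> A \<times> B \<subseteq> D"
      using D[unfolded openin_prod_topology_alt, rule_format] by auto
    then obtain A B where AB: "openin T A" "open B" "fst p \<in> A" "snd p \<in> B" "A \<times> B \<subseteq> D"
      by auto
    obtain A' where A': "open A'" "A = \<Theta> -` A' \<inter> S"
      using AB(1) unfolding T_def openin_pullback_euclidean by blast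
    have "A' \<times> B \<in> {A \<times> B | A B. open A \<and> open B \<and> (\<Theta> -` A \<inter> S) \<times> B \<subseteq> D}"
      using AB(2,5) A' by blast
    moreover have "(\<Theta> (fst p), snd p) \<in> A' \<times> B" using AB(3,4) A'(2) by simp
    ultimately have "(\<Theta> (fst p), snd p) \<in> W" unfolding W_def by (rule UnionI)
    then show "p \<in> (\<lambda>p. (\<Theta> (fst p), snd p)) -` W \<inter> (S \<times> UNIV)" using p DS by auto
  next
    fix p assume p: "p \<in> (\<lambda>p. (\<Theta> (fst p), snd p)) -` W \<inter> (S \<times> UNIV)"
    then have "(\<Theta> (fst p), snd p) \<in> W" by simp
    then obtain A B where "(\<Theta> -` A \<inter> S) \<times> B \<subseteq> D" "\<Theta> (fst p) \<in> A" "snd p \<in> B"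
      unfolding W_def by auto
    moreover have "fst p \<in> S" using p by auto
    ultimately show "p \<in> D"
      by (intro subsetD[of "(\<Theta> -` A \<inter> S) \<times> B" D]) (simp_all add: mem_Times_iff)
  qed
  then show ?thesis
    using measurable_sets[OF m borel_open[OF \<open>open W\<close>]] by (simp add: space_pair_measure spN)
qed

section \<open>The topology of the information states\<close>

lemma prob_measuresD:
  assumes "\<mu> \<in> prob_measures"
  shows "prob_space \<mu>" "sets \<mu> = sets borel" "space \<mu> = UNIV"
proof -
  show *: "prob_space \<mu>" "sets \<mu> = sets borel" using assms by (auto simp: prob_measures_def space_prob_algebra)
  show "space \<mu> = UNIV" using sets_eq_imp_space_eq[OF *(2)] by simp
qed

text \<open>
  The integrals of the countable family above already generate the weak topology. In the topology
  that they induce, \<open>\<mu> \<mapsto> \<mu>(G)\<close> is lower semicontinuous for open \<open>G\<close>; hence so is \<open>\<mu> \<mapsto> \<integral> \<phi> d\<mu>\<close> for every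
  bounded continuous \<open>\<phi>\<close>, and replacing \<open>\<phi>\<close> by \<open>- \<phi>\<close> gives continuity.
\<close>

lemma weak_topology_pullback:
  obtains \<Psi> :: "'x::{metric_space, second_countable_topology} measure \<Rightarrow> nat \<Rightarrow> real"
  where "weak_topology = pullback_topology prob_measures \<Psi> euclidean"
proof -
  obtain \<psi> :: "nat \<Rightarrow> 'x \<Rightarrow> real" where \<psi>: "\<And>m. continuous_on UNIV (\<psi> m)" "\<And>m x. 0 \<le> \<psi> m x" "\<And>m x. \<psi> m x \<le> 1"
    "\<And>G. open G \<Longrightarrow> \<exists>s. \<forall>x. incseq (\<lambda>n. \<psi> (s n) x) \<and> (\<lambda>n. \<psi> (s n) x) \<longlonglongrightarrow> indicator G x"
    using countable_urysohn_family by blast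
  define \<Psi> where "\<Psi> \<mu> m = (\<integral>x. \<psi> m x \<partial>\<mu>)" for \<mu> m
  define T where "T = pullback_topology prob_measures \<Psi> euclidean"
  have tT: "topspace T = prob_measures" by (simp add: T_def topspace_pullback_euclidean)
  have meas: "\<phi> \<in> borel_measurable \<mu>" if "\<mu> \<in> prob_measures" "continuous_on UNIV \<phi>" for \<mu> and \<phi> :: "'x \<Rightarrow> real"
    using borel_measurable_continuous_onI[OF that(2)] prob_measuresD(2)[OF that(1)]
    by (simp cong: measurable_cong_sets)
  have coord: "continuous_map T euclideanreal (\<lambda>\<mu>. \<integral>x. \<psi> m x \<partial>\<mu>)" for m
    using continuous_map_pullback_euclidean[OF continuous_on_product_coordinates[of m], of prob_measures \<Psi>]
    by (simp add: T_def \<Psi>_def)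
  have open_lsc: "lower_semicontinuous_map T (\<lambda>\<mu>. measure \<mu> G)" if G: "open G" for G
  proof -
    obtain s where s: "\<And>x. incseq (\<lambda>n. \<psi> (s n) x)" "\<And>x. (\<lambda>n. \<psi> (s n) x) \<longlonglongrightarrow> indicator G x"
      using \<psi>(4)[OF G] by blast
    have "G \<in> sets \<mu>" if "\<mu> \<in> prob_measures" for \<mu>
      using G by (simp add: prob_measuresD(2)[OF that])
    then show ?thesis
      by (intro lsc_measure_open[where f="\<lambda>n. \<psi> (s n)"])
        (use s \<psi> G tT meas prob_measuresD in \<open>auto intro!: continuous_imp_lsc coord\<close>)
  qed
  have int_lsc: "lower_semicontinuous_map T (\<lambda>\<mu>. \<integral>x. \<phi> x \<partial>\<mu>)"
    if \<phi>: "continuous_on UNIV \<phi>" "bounded (range \<phi>)" for \<phi> :: "'x \<Rightarrow> real"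
  proof -
    obtain b where b: "\<And>x. \<bar>\<phi> x\<bar> \<le> b" using \<phi>(2) by (auto simp: bounded_iff)
    show ?thesis
    proof (rule lsc_integral)
      fix t
      have "open {x. t < \<phi> x}" using \<phi>(1) by (simp add: open_Collect_less)
      then show "lower_semicontinuous_map T (\<lambda>\<mu>. measure \<mu> {x \<in> space \<mu>. t < \<phi> x})"
        using open_lsc[of "{x. t < \<phi> x}"] tT
        by (subst lsc_cong[of T _ "\<lambda>\<mu>. measure \<mu> {x. t < \<phi> x}"]) (auto simp: prob_measuresD(3))
    qed (use b \<phi> tT meas prob_measuresD in auto)
  qed
  have int_cont: "continuous_map T euclideanreal (\<lambda>\<mu>. \<integral>x. \<phi> x \<partial>\<mu>)"
    if \<phi>: "continuous_on UNIV \<phi>" "bounded (range \<phi>)" for \<phi> :: "'x \<Rightarrow> real"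
  proof -
    have "bounded (range (\<lambda>x. - \<phi> x))"
      using bounded_uminus[of "range \<phi>"] \<phi>(2) by (simp add: image_image)
    then have "lower_semicontinuous_map T (\<lambda>\<mu>. \<integral>x. - \<phi> x \<partial>\<mu>)"
      using \<phi> by (intro int_lsc continuous_intros)
    then show ?thesis using int_lsc[OF \<phi>] by (simp add: continuous_iff_lsc)
  qed
  have "openin weak_topology D \<longleftrightarrow> openin T D" for D
  proof
    assume "openin weak_topology D"
    then have "generate_topology_on {{\<mu> \<in> prob_measures. (\<integral>x. \<phi> x \<partial>\<mu>) \<in> W} | (\<phi> :: 'x \<Rightarrow> real) W.
        continuous_on UNIV \<phi> \<and> bounded (range \<phi>) \<and> open W} D"
      unfolding weak_topology_def openin_topology_generated_by_iff .
    then show "openin T D"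
    proof (rule generate_topology_on_coarsest[rotated 2])
      fix A assume "A \<in> {{\<mu> \<in> prob_measures. (\<integral>x. \<phi> x \<partial>\<mu>) \<in> W} | (\<phi> :: 'x \<Rightarrow> real) W.
        continuous_on UNIV \<phi> \<and> bounded (range \<phi>) \<and> open W}"
      then obtain \<phi> :: "'x \<Rightarrow> real" and W where
        *: "A = {\<mu> \<in> prob_measures. (\<integral>x. \<phi> x \<partial>\<mu>) \<in> W}" "continuous_on UNIV \<phi>" "bounded (range \<phi>)" "open W"
        by blast
      show "openin T A"
        using openin_continuous_map_preimage[OF int_cont[OF *(2,3)], of W] * tT by simp
    qed simp
  next
    assume "openin T D"
    then obtain W where W: "open W" "D = \<Psi> -` W \<inter> prob_measures"
      unfolding T_def openin_pullback_euclidean by blast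
    have "continuous_map weak_topology euclideanreal (\<lambda>\<mu>. \<Psi> \<mu> m)" for m
      unfolding continuous_map_def topspace_weak_topology
    proof (intro conjI allI impI)
      fix U :: "real set" assume U: "openin euclidean U"
      have "bounded (range (\<psi> m))" using \<psi>(2,3) by (intro boundedI[of _ 1]) auto
      with U \<psi>(1) show "openin weak_topology {\<mu> \<in> prob_measures. \<Psi> \<mu> m \<in> U}"
        unfolding weak_topology_def \<Psi>_def by (intro topology_generated_by_Basis) auto
    qed simp
    then have "continuous_map weak_topology euclidean \<Psi>"
      unfolding euclidean_product_topology[symmetric] continuous_map_componentwise_UNIV by blast
    from openin_continuous_map_preimage[OF this, of W] W
    show "openin weak_topology D"
      by (simp add: topspace_weak_topology vimage_def Int_def conj_commute)
  qed
  then have "weak_topology = T" by (simp add: topology_eq)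
  with that show ?thesis unfolding T_def by blast
qed

text \<open>
  The disjoint union is encoded by adding the class index as a further real coordinate: distinct indices
  are at distance at least \<open>1\<close>, so balls of radius \<open>1\<close> separate the components.
\<close>

lemma info_topology_pullback:
  fixes M :: "('x::polish_space, 'u, 'e, 'v) pomdp"
  obtains \<Theta> :: "'x info \<Rightarrow> real \<times> (nat \<Rightarrow> real)"
  where "info_topology M = pullback_topology (info_states M) \<Theta> euclidean"
proof -
  obtain \<Psi> :: "'x measure \<Rightarrow> nat \<Rightarrow> real" where \<Psi>: "weak_topology = pullback_topology prob_measures \<Psi> euclidean"
    using weak_topology_pullback by blast
  define \<Theta> where "\<Theta> I = (real (fst I), \<Psi> (snd I))" for I
  have cls: "class_measures M j \<subseteq> prob_measures" for j by (auto simp: class_measures_def)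
  have sub: "openin (subtopology weak_topology (class_measures M j)) A \<longleftrightarrow>
      (\<exists>W. open W \<and> A = \<Psi> -` W \<inter> class_measures M j)" for j A
    using cls[of j] unfolding openin_subtopology \<Psi> openin_pullback_euclidean by blast
  have "openin (info_topology M) D \<longleftrightarrow> openin (pullback_topology (info_states M) \<Theta> euclidean) D" for D
  proof
    assume "openin (info_topology M) D"
    then have "D \<subseteq> info_states M" and
      D: "\<And>j. j \<in> classes M \<Longrightarrow> \<exists>W. open W \<and> {\<mu>. (j, \<mu>) \<in> D} = \<Psi> -` W \<inter> class_measures M j"
      using openin_subset[of "info_topology M" D] topspace_info_topology[of M]
      by (simp_all add: info_topology_def openin_sum_topology sub)
    from D obtain W where W: "\<And>j. j \<in> classes M \<Longrightarrow> open (W j)"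
      "\<And>j. j \<in> classes M \<Longrightarrow> {\<mu>. (j, \<mu>) \<in> D} = \<Psi> -` W j \<inter> class_measures M j" by metis
    let ?W = "\<Union>j\<in>classes M. ball (real j) 1 \<times> W j"
    have "open ?W" using W(1) by (intro open_UN ballI open_Times) auto
    moreover have "D = \<Theta> -` ?W \<inter> info_states M"
    proof (intro equalityI subsetI)
      fix I assume I: "I \<in> D"
      then have "fst I \<in> classes M" "snd I \<in> {\<mu>. (fst I, \<mu>) \<in> D}" "I \<in> info_states M"
        using \<open>D \<subseteq> info_states M\<close> by (auto simp: info_states_def)
      with W(2)[of "fst I"] show "I \<in> \<Theta> -` ?W \<inter> info_states M"
        by (auto simp: \<Theta>_def intro!: bexI[of _ "fst I"])
    next
      fix I assume "I \<in> \<Theta> -` ?W \<inter> info_states M"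
      then obtain k where k: "k \<in> classes M" "dist (real k) (real (fst I)) < 1" "\<Psi> (snd I) \<in> W k"
        "I \<in> info_states M" by (auto simp: \<Theta>_def)
      then have "k = fst I" by (simp add: dist_real_def)
      with k W(2)[of k] have "snd I \<in> {\<mu>. (k, \<mu>) \<in> D}" by (auto simp: info_states_def)
      then show "I \<in> D" using \<open>k = fst I\<close> by simp
    qed
    ultimately show "openin (pullback_topology (info_states M) \<Theta> euclidean) D"
      unfolding openin_pullback_euclidean by blast
  next
    assume "openin (pullback_topology (info_states M) \<Theta> euclidean) D"
    then obtain W where W: "open W" "D = \<Theta> -` W \<inter> info_states M"
      unfolding openin_pullback_euclidean by blast
    have "\<exists>V. open V \<and> {\<mu>. (j, \<mu>) \<in> D} = \<Psi> -` V \<inter> class_measures M j" if j: "j \<in> classes M" for j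
    proof (intro exI conjI)
      have "open ((\<lambda>y. (real j, y)) -` W)"
        using W(1) by (intro open_vimage continuous_intros) auto
      then show "open {y. (real j, y) \<in> W}" by (simp add: vimage_def)
      show "{\<mu>. (j, \<mu>) \<in> D} = \<Psi> -` {y. (real j, y) \<in> W} \<inter> class_measures M j"
        using j by (auto simp: W(2) \<Theta>_def info_states_def)
    qed
    moreover have "D \<subseteq> Sigma (classes M) (topspace \<circ> (\<lambda>j. subtopology weak_topology (class_measures M j)))"
      using W(2) by (auto simp: info_states_def class_measures_def topspace_weak_topology)
    ultimately show "openin (info_topology M) D"
      unfolding info_topology_def openin_sum_topology sub by blast
  qed
  then have "info_topology M = pullback_topology (info_states M) \<Theta> euclidean"
    by (simp add: topology_eq)
  with that show ?thesis by blast
qed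

section \<open>Measurable selection\<close>

text \<open>
  The Kuratowski and Ryll-Nardzewski theorem for closed-valued maps. Each point \<open>x\<close> follows a
  sequence of indices of balls around the points \<open>e i\<close> of a countable dense set, with radii \<open>(1 / 2) ^ n\<close>:
  the next index is the least one for which \<open>A x\<close> still meets the intersection of the balls chosen so
  far. The first \<open>n\<close> indices take only countably many values and are determined by which closed sets
  \<open>A x\<close> meets, so they depend measurably on \<open>x\<close>; the centres of the balls converge to a point of \<open>A x\<close>.
\<close>

lemma measurable_selection:
  fixes A :: "'i \<Rightarrow> 'u::polish_space set"
  assumes closed: "\<And>x. x \<in> space N \<Longrightarrow> closed (A x)" and nonempty: "\<And>x. x \<in> space N \<Longrightarrow> A x \<noteq> {}"
    and hits: "\<And>C. closed C \<Longrightarrow> {x \<in> space N. A x \<inter> C \<noteq> {}} \<in> sets N"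
  obtains f where "f \<in> N \<rightarrow>\<^sub>M borel" "\<And>x. x \<in> space N \<Longrightarrow> f x \<in> A x"
proof -
  obtain Q :: "'u set" where Q: "countable Q" "\<And>X. open X \<Longrightarrow> X \<noteq> {} \<Longrightarrow> \<exists>d\<in>Q. d \<in> X"
    using countable_dense_setE by blast
  have Qne: "Q \<noteq> {}" using Q(2)[of UNIV] by auto
  define e where "e = from_nat_into Q"
  \<comment> \<open>Index sequences are stored with the most recent choice first.\<close>
  define B where "B = rec_list UNIV (\<lambda>i l X. X \<inter> cball (e i) ((1 / 2) ^ length l))"
  have B_simps: "B [] = UNIV" "B (i # l) = B l \<inter> cball (e i) ((1 / 2) ^ length l)" for i l
    by (auto simp: B_def)
  have B_closed: "closed (B l)" for l by (induction l) (auto simp: B_simps)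
  define s where "s x = rec_nat [] (\<lambda>n l. (LEAST i. A x \<inter> B (i # l) \<noteq> {}) # l)" for x
  have s_simps: "s x 0 = []" "s x (Suc n) = (LEAST i. A x \<inter> B (i # s x n) \<noteq> {}) # s x n" for x n
    by (auto simp: s_def)
  have len: "length (s x n) = n" for x n by (induction n) (auto simp: s_simps)
  have hit: "A x \<inter> B (s x n) \<noteq> {}" if x: "x \<in> space N" for x n
  proof (induction n)
    case (Suc n)
    then obtain a where a: "a \<in> A x" "a \<in> B (s x n)" by blast
    obtain d where d: "d \<in> Q" "d \<in> ball a ((1 / 2) ^ n)"
      using Q(2)[OF open_ball, of a "(1 / 2) ^ n"] by (metis ball_eq_empty not_le zero_less_divide_1_iff zero_less_numeral zero_less_power)
    obtain i where "e i = d" using from_nat_into_surj[OF Q(1) d(1)] unfolding e_def by blast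
    with a d have "a \<in> A x \<inter> B (i # s x n)" by (simp add: B_simps len dist_commute)
    then have "\<exists>i. A x \<inter> B (i # s x n) \<noteq> {}" by blast
    from LeastI_ex[OF this] show ?case by (simp add: s_simps)
  qed (use nonempty[OF x] in \<open>simp add: s_simps B_simps\<close>)
  have s_meas: "(\<lambda>x. s x n) \<in> N \<rightarrow>\<^sub>M count_space UNIV" for n
  proof (induction n)
    case (Suc n)
    have "(\<lambda>x. (LEAST i. A x \<inter> B (i # l) \<noteq> {}) # l) \<in> N \<rightarrow>\<^sub>M count_space UNIV" for l
    proof -
      have "Measurable.pred N (\<lambda>x. A x \<inter> B (i # l) \<noteq> {})" for i
        using hits[OF B_closed[of "i # l"]] by (simp add: pred_def)
      then have "(\<lambda>x. LEAST i. A x \<inter> B (i # l) \<noteq> {}) \<in> N \<rightarrow>\<^sub>M count_space UNIV"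
        by (rule measurable_Least)
      from measurable_compose[OF this measurable_count_space, of "\<lambda>i. i # l"] show ?thesis .
    qed
    from measurable_compose_countable[OF this Suc] show ?case by (simp add: s_simps)
  qed (simp add: s_simps)
  define g where "g n x = e (hd (s x (Suc n)))" for n x
  have g_meas: "g n \<in> N \<rightarrow>\<^sub>M borel" for n
    unfolding g_def by (rule measurable_compose[OF s_meas]) simp
  have "\<exists>l\<in>A x. (\<lambda>n. g n x) \<longlonglongrightarrow> l" if x: "x \<in> space N" for x
  proof -
    have "\<forall>n. \<exists>a. a \<in> A x \<and> a \<in> B (s x (Suc n))"
    proof
      show "\<exists>a. a \<in> A x \<and> a \<in> B (s x (Suc n))" for n
        using hit[OF x, of "Suc n"] by (simp only: Int_def ex_in_conv[symmetric] mem_Collect_eq)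
    qed
    from choice[OF this] obtain a where a: "\<And>n. a n \<in> A x" "\<And>n. a n \<in> B (s x (Suc n))" by (auto simp only:)
    have B_dec: "B (s x m) \<subseteq> B (s x n)" if "n \<le> m" for n m
      using that by (induction rule: dec_induct) (auto simp: s_simps B_simps)
    have near: "dist (g n x) (a m) \<le> (1 / 2) ^ n" if "n \<le> m" for n m
    proof -
      have "a m \<in> B (s x (Suc n))" using a(2)[of m] B_dec[of "Suc n" "Suc m"] that by auto
      then show ?thesis by (simp add: s_simps B_simps len g_def)
    qed
    have small: "\<exists>n. 2 * (1 / 2) ^ n < r" if "r > 0" for r :: real
    proof -
      have "\<exists>n. (1 / 2) ^ n < r / 2" using that by (intro real_arch_pow_inv) auto
      then show ?thesis by (auto simp: field_simps)
    qed
    have "Cauchy a"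
    proof (rule metric_CauchyI)
      fix r :: real assume "r > 0"
      then obtain n where n: "2 * (1 / 2) ^ n < r" using small by blast
      have "dist (a m) (a m') < r" if "m \<ge> n" "m' \<ge> n" for m m'
        using near[OF that(1)] near[OF that(2)] dist_triangle3[of "a m" "a m'" "g n x"] n by simp
      then show "\<exists>n. \<forall>m\<ge>n. \<forall>m'\<ge>n. dist (a m) (a m') < r" by blast
    qed
    then obtain l where l: "a \<longlonglongrightarrow> l" using Cauchy_convergent convergent_def by blast
    have "l \<in> A x" by (rule closed_sequentially[OF closed[OF x] a(1) l])
    moreover have "(\<lambda>n. g n x) \<longlonglongrightarrow> l"
    proof -
      have "(\<lambda>n. (1 / 2) ^ n + dist (a n) l) \<longlonglongrightarrow> 0 + 0"
        by (intro tendsto_add LIMSEQ_realpow_zero iffD1[OF tendsto_dist_iff l]) simp_all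
      moreover have "norm (dist (g n x) l) \<le> (1 / 2) ^ n + dist (a n) l" for n
        using near[of n n] dist_triangle[of "g n x" l "a n"] by simp
      ultimately have "(\<lambda>n. dist (g n x) l) \<longlonglongrightarrow> 0"
        using Lim_null_comparison[of "\<lambda>n. dist (g n x) l" "\<lambda>n. (1 / 2) ^ n + dist (a n) l"] by simp
      then show ?thesis by (rule iffD2[OF tendsto_dist_iff])
    qed
    ultimately show ?thesis by blast
  qed
  then have "\<forall>x\<in>space N. \<exists>l. l \<in> A x \<and> (\<lambda>n. g n x) \<longlonglongrightarrow> l" by blast
  from bchoice[OF this] obtain f where
    f: "\<And>x. x \<in> space N \<Longrightarrow> f x \<in> A x" "\<And>x. x \<in> space N \<Longrightarrow> (\<lambda>n. g n x) \<longlonglongrightarrow> f x" by blast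
  have "f \<in> N \<rightarrow>\<^sub>M borel" by (rule borel_measurable_LIMSEQ_metric[OF g_meas f(2)])
  with f(1) that show ?thesis by blast
qed

section \<open>The filter as a stochastic kernel\<close>

text \<open>
  \<^const>\<open>measure_of\<close> yields the intended measure only for a countably additive set function. This is checked
  below by exhibiting, for each set function of the model, a measure with the same values.
\<close>

lemma measure_of_eq_measure:
  assumes "space N = \<Omega>" "sets N = A" "\<And>C. C \<in> A \<Longrightarrow> f C = emeasure N C"
  shows "measure_of \<Omega> A f = N"
proof -
  have "measure_of (space N) (sets N) f = measure_of (space N) (sets N) (emeasure N)"
    by (intro measure_of_eq[OF sets.space_closed]) (simp add: sets.sigma_sets_eq assms(3) flip: assms(2))
  also have "\<dots> = N" by (rule measure_of_of_measure)
  finally show ?thesis unfolding assms(1,2) .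
qed

lemma space_info_borel: "space (info_borel M) = info_states M"
  and sets_info_borel: "sets (info_borel M) = sigma_sets (info_states M) {D. openin (info_topology M) D}"
proof -
  have "{D. openin (info_topology M) D} \<subseteq> Pow (info_states M)"
    using openin_subset topspace_info_topology by fastforce
  then show "space (info_borel M) = info_states M"
    "sets (info_borel M) = sigma_sets (info_states M) {D. openin (info_topology M) D}"
    unfolding info_borel_def by (auto simp: space_measure_of sets_measure_of)
qed

lemma openin_sets_info_borel: "openin (info_topology M) D \<Longrightarrow> D \<in> sets (info_borel M)"
  unfolding sets_info_borel by (intro sigma_sets.Basic) simp

lemma lsc_info_borel_measurable:
  "lower_semicontinuous_map (info_topology M) v \<Longrightarrow> v \<in> borel_measurable (info_borel M)"
  by (rule lsc_borel_measurable) (auto simp: space_info_borel topspace_info_topology openin_sets_info_borel)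

text \<open>
  Semicontinuity refers to the product topology, measurability to the product sigma-algebra; the induced
  form of the topology of the information states connects the two.
\<close>

lemma lsc_step_space_measurable:
  fixes M :: "('x::polish_space, 'u::polish_space, 'e, 'v) pomdp"
  assumes "lower_semicontinuous_map (prod_topology (info_topology M) (euclidean :: 'u topology)) F"
  shows "F \<in> borel_measurable (info_borel M \<Otimes>\<^sub>M borel)"
proof (rule lsc_borel_measurable[OF assms])
  show "space (info_borel M \<Otimes>\<^sub>M borel) = topspace (prod_topology (info_topology M) (euclidean :: 'u topology))"
    by (simp add: space_pair_measure space_info_borel topspace_info_topology)
  fix D :: "('x info \<times> 'u) set" assume D: "openin (prod_topology (info_topology M) euclidean) D"
  obtain \<Theta> :: "'x info \<Rightarrow> real \<times> (nat \<Rightarrow> real)"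
    where \<Theta>: "info_topology M = pullback_topology (info_states M) \<Theta> euclidean"
    using info_topology_pullback by blast
  show "D \<in> sets (info_borel M \<Otimes>\<^sub>M borel)"
    using open_prod_pullback_measurable[OF D[unfolded \<Theta>]] by (simp add: info_borel_def \<Theta>)
qed

context pomdp_model begin

lemma noise_laws:
  shows "prob_space (law_eta M)" "sets (law_eta M) = sets borel"
    "prob_space (law_eps M)" "sets (law_eps M) = sets borel"
  using prob_measuresD[OF law_eta] prob_measuresD[OF law_eps] by auto

lemma noise_pair: "law_eta M \<Otimes>\<^sub>M law_eps M \<in> space (prob_algebra (borel \<Otimes>\<^sub>M borel))"
  using noise_laws by (auto simp: space_prob_algebra prob_space_pair intro!: sets_pair_measure_cong)

lemma trans_prob_eq_distr:
  "trans_prob M x u = distr (law_eta M \<Otimes>\<^sub>M law_eps M) borel (\<lambda>(e, v). dyn M (x, u, e, v))"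
  unfolding trans_prob_def
proof (rule measure_of_eq_measure)
  interpret eps: prob_space "law_eps M" by (rule noise_laws)
  have "(\<lambda>(e, v). dyn M (x, u, e, v)) \<in> borel \<Otimes>\<^sub>M borel \<rightarrow>\<^sub>M borel"
    unfolding case_prod_beta by (rule measurable_compose[OF _ dyn_measurable]) measurable
  then have [measurable]: "(\<lambda>(e, v). dyn M (x, u, e, v)) \<in> law_eta M \<Otimes>\<^sub>M law_eps M \<rightarrow>\<^sub>M borel"
    using noise_laws by (simp cong: measurable_cong_sets sets_pair_measure_cong)
  fix C assume [measurable]: "C \<in> sets (borel :: 'x measure)"
  show "(\<integral>\<^sup>+ e. \<integral>\<^sup>+ v. indicator C (dyn M (x, u, e, v)) \<partial>law_eps M \<partial>law_eta M) =
      emeasure (distr (law_eta M \<Otimes>\<^sub>M law_eps M) borel (\<lambda>(e, v). dyn M (x, u, e, v))) C"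
    by (subst emeasure_distr, measurable, subst eps.emeasure_pair_measure)
      (auto intro!: nn_integral_cong simp: indicator_def space_pair_measure)
qed auto

lemma trans_prob_kernel: "(\<lambda>x. trans_prob M x u) \<in> borel \<rightarrow>\<^sub>M prob_algebra borel"
  unfolding trans_prob_eq_distr
proof (rule measurable_distr_prob_space2)
  show "(\<lambda>x. law_eta M \<Otimes>\<^sub>M law_eps M) \<in> borel \<rightarrow>\<^sub>M prob_algebra (borel \<Otimes>\<^sub>M borel)"
    using noise_pair by simp
  show "(\<lambda>(x, y). case y of (e, v) \<Rightarrow> dyn M (x, u, e, v)) \<in> borel \<Otimes>\<^sub>M borel \<Otimes>\<^sub>M borel \<rightarrow>\<^sub>M borel"
    unfolding case_prod_beta by (rule measurable_compose[OF _ dyn_measurable]) measurable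
qed

lemma predict_prob:
  assumes \<mu>: "\<mu> \<in> prob_measures"
  shows "predict M u \<mu> \<in> prob_measures"
proof -
  have "predict M u \<mu> = \<mu> \<bind> (\<lambda>x. trans_prob M x u)"
    unfolding predict_def
    using emeasure_bind_prob_algebra[OF \<mu>[unfolded prob_measures_def] trans_prob_kernel]
      sets_bind'[OF \<mu>[unfolded prob_measures_def] trans_prob_kernel]
      sets_eq_imp_space_eq[OF sets_bind'[OF \<mu>[unfolded prob_measures_def] trans_prob_kernel]]
    by (intro measure_of_eq_measure) simp_all
  then show ?thesis
    using prob_space_bind'[OF \<mu>[unfolded prob_measures_def] trans_prob_kernel]
      sets_bind'[OF \<mu>[unfolded prob_measures_def] trans_prob_kernel]
    by (simp add: prob_measures_def space_prob_algebra)
qed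

lemma classes_partition:
  shows "finite (classes M)" "\<And>k. k \<in> classes M \<Longrightarrow> obs M k \<in> sets borel"
    "disjoint_family_on (obs M) (classes M)" "(\<Union>k\<in>classes M. obs M k) = UNIV"
proof -
  show "finite (classes M)" by (simp add: classes_def)
  show "obs M k \<in> sets borel" if "k \<in> classes M" for k using that obs_sets by (simp add: classes_def)
  show "disjoint_family_on (obs M) (classes M)"
    by (rule disjoint_family_on_mono[OF _ obs_disjoint]) (auto simp: classes_def)
  show "(\<Union>k\<in>classes M. obs M k) = UNIV"
    using obs_cover by (fastforce simp: classes_def)
qed

text \<open>
  The update is the prediction conditioned on the observed class, or the default law \<open>rho\<close> of that
  class if it has prediction probability \<open>0\<close>; both are concentrated on the class.
\<close>

lemma filter_upd_class:
  assumes \<mu>: "\<mu> \<in> prob_measures" and k: "k \<in> classes M"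
  shows "filter_upd M k \<mu> u \<in> class_measures M k"
proof (cases "obs_prob M k \<mu> u > 0")
  case True
  let ?P = "predict M u \<mu>"
  note P = prob_measuresD[OF predict_prob[OF \<mu>, of u]]
  interpret P: prob_space ?P by (rule P)
  have O: "obs M k \<in> sets ?P" using classes_partition(2)[OF k] P by simp
  have e: "emeasure ?P (obs M k) = ennreal (obs_prob M k \<mu> u)"
    by (simp add: obs_prob_def P.emeasure_eq_measure)
  have eq: "filter_upd M k \<mu> u = uniform_measure ?P (obs M k)"
    unfolding filter_upd_def using True O P
    by (simp add: e Int_commute) (intro measure_of_eq_measure, auto simp: e Int_commute)
  have ps: "prob_space (uniform_measure ?P (obs M k))"
    using True e by (intro prob_space_uniform_measure) auto
  have "emeasure (uniform_measure ?P (obs M k)) (obs M k) = 1"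
    using True e by (intro emeasure_uniform_measure_1) auto
  then have "measure (uniform_measure ?P (obs M k)) (obs M k) = 1" by (simp add: measure_def)
  with ps P show ?thesis
    by (simp add: eq class_measures_def prob_measures_def space_prob_algebra)
next
  case False
  then show ?thesis using rho[OF k] by (simp add: filter_upd_def class_measures_def)
qed

text \<open>
  The kernel puts mass \<open>p\<^sub>k\<close> on the \<open>k\<close>-th updated state, and the classes partition the state space, so
  the masses sum to \<open>1\<close>.
\<close>

lemma info_kernel_prob:
  assumes I: "I \<in> info_states M"
  shows "info_kernel M I u \<in> space (prob_algebra (info_borel M))"
proof -
  have \<mu>: "snd I \<in> prob_measures" using I by (auto simp: info_states_def class_measures_def)
  let ?P = "predict M u (snd I)"
  note P = prob_measuresD[OF predict_prob[OF \<mu>, of u]]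
  interpret P: prob_space ?P by (rule P)
  let ?p = "\<lambda>k. ennreal (obs_prob M k (snd I) u)" and ?\<Phi> = "\<lambda>k. (k, filter_upd M k (snd I) u)"
  let ?N = "distr (point_measure (classes M) ?p) (info_borel M) ?\<Phi>"
  have mem: "?\<Phi> k \<in> info_states M" if "k \<in> classes M" for k
    using filter_upd_class[OF \<mu> that] that by (simp add: info_states_def)
  have m: "?\<Phi> \<in> point_measure (classes M) ?p \<rightarrow>\<^sub>M info_borel M"
    using mem by (auto simp: measurable_point_measure_eq1 space_info_borel)
  have em: "emeasure ?N D = (\<Sum>k\<in>classes M. ?p k * indicator D (?\<Phi> k))" if D: "D \<in> sets (info_borel M)" for D
  proof -
    have "emeasure ?N D = (\<Sum>k\<in>?\<Phi> -` D \<inter> classes M. ?p k)"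
      using classes_partition(1) by (subst emeasure_distr[OF m D], subst emeasure_point_measure_finite)
        (auto simp: space_point_measure)
    also have "\<dots> = (\<Sum>k\<in>classes M. ?p k * indicator D (?\<Phi> k))"
      using classes_partition(1) by (intro sum.mono_neutral_cong_left) (auto simp: indicator_def)
    finally show ?thesis .
  qed
  have eq: "info_kernel M I u = ?N"
    unfolding info_kernel_def by (rule measure_of_eq_measure) (auto simp: space_info_borel em)
  have "emeasure ?N (space ?N) = (\<Sum>k\<in>classes M. ?p k)"
    using em[OF sets.top] mem by (auto simp: space_info_borel intro!: sum.cong)
  also have "\<dots> = ennreal (\<Sum>k\<in>classes M. measure ?P (obs M k))"
    by (simp add: obs_prob_def sum_ennreal)
  also have "(\<Sum>k\<in>classes M. measure ?P (obs M k)) = measure ?P (\<Union>k\<in>classes M. obs M k)"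
    using classes_partition P by (intro P.finite_measure_finite_Union[symmetric]) auto
  also have "\<dots> = 1" using P.prob_space P(3) classes_partition(4) by simp
  finally have "prob_space ?N" by (intro prob_spaceI) simp
  then show ?thesis by (simp add: eq space_prob_algebra)
qed

lemma info_kernel_probability:
  assumes "I \<in> info_states M"
  shows "prob_space (info_kernel M I u)" "sets (info_kernel M I u) = sets (info_borel M)"
    "space (info_kernel M I u) = info_states M"
  using info_kernel_prob[OF assms, of u] sets_eq_imp_space_eq[of "info_kernel M I u" "info_borel M"]
  by (auto simp: space_prob_algebra space_info_borel)

end

section \<open>The Bellman operator on lower semicontinuous functions\<close>

locale semicontinuous_pomdp = pomdp_model M
  for M :: "('x::polish_space, 'u::polish_space, 'e::polish_space, 'v::polish_space) pomdp" +
  fixes c :: real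
  assumes cost_bounded: "\<And>x u. \<bar>cost M x u\<bar> \<le> c"
    and compact_actions: "compact (UNIV :: 'u set)"
    and cost_lsc: "lower_semicontinuous_map
      (prod_topology (info_topology M) (euclidean :: 'u topology)) (\<lambda>(I, u). filt_cost M I u)"
    and kernel_continuous: "weakly_continuous_kernel M"
begin

abbreviation "state_action_topology \<equiv> prod_topology (info_topology M) (euclidean :: 'u topology)"

text \<open>
  The step from weak continuity, a statement about continuous functions, to open sets; both the
  measurability of the kernel and the semicontinuity of the Bellman operator come from it.
\<close>

lemma kernel_open_lsc:
  assumes D: "openin (info_topology M) D"
  shows "lower_semicontinuous_map state_action_topology (\<lambda>z. measure (info_kernel M (fst z) (snd z)) D)"
proof -
  obtain \<Theta> :: "'x info \<Rightarrow> real \<times> (nat \<Rightarrow> real)"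
    where \<Theta>: "info_topology M = pullback_topology (info_states M) \<Theta> euclidean"
    using info_topology_pullback by blast
  show ?thesis
  proof (rule lsc_measure_open_pullback[where S="info_states M" and \<Theta>=\<Theta>])
    show "openin (pullback_topology (info_states M) \<Theta> euclidean) D" using D \<Theta> by simp
    fix z assume "z \<in> topspace state_action_topology"
    then have z: "fst z \<in> info_states M" by (auto simp: topspace_info_topology)
    show "prob_space (info_kernel M (fst z) (snd z))" "space (info_kernel M (fst z) (snd z)) = info_states M"
      using info_kernel_probability[OF z] by auto
    show "D \<in> sets (info_kernel M (fst z) (snd z))" if "openin (pullback_topology (info_states M) \<Theta> euclidean) D" for D
      using that \<Theta> by (simp add: info_kernel_probability(2)[OF z] openin_sets_info_borel)
  next
    fix v assume "continuous_map (pullback_topology (info_states M) \<Theta> euclidean) euclideanreal v"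
      "bounded (v ` info_states M)"
    then show "continuous_map state_action_topology euclideanreal (\<lambda>z. \<integral>x. v x \<partial>info_kernel M (fst z) (snd z))"
      using kernel_continuous unfolding weakly_continuous_kernel_def \<Theta> case_prod_beta by blast
  qed
qed

text \<open>
  Open sets form an intersection-stable generator of the Borel sets, and on them the kernel is lower
  semicontinuous in the state-action pair.
\<close>

lemma info_kernel_measurable:
  "(\<lambda>z. info_kernel M (fst z) (snd z)) \<in> step_space M \<rightarrow>\<^sub>M prob_algebra (info_borel M)"
proof (rule measurable_prob_algebra_generated[OF sets_info_borel])
  show "Int_stable {D. openin (info_topology M) D}" by (auto simp: Int_stable_def)
  show "{D. openin (info_topology M) D} \<subseteq> Pow (info_states M)"
    using openin_subset topspace_info_topology by fastforce
  fix z assume "z \<in> space (step_space M)"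
  then have z: "fst z \<in> info_states M" by (auto simp: step_space_def space_pair_measure space_info_borel)
  show "prob_space (info_kernel M (fst z) (snd z))"
    "sets (info_kernel M (fst z) (snd z)) = sets (info_borel M)"
    using info_kernel_probability[OF z] by auto
next
  fix D assume "D \<in> {D. openin (info_topology M) D}"
  then have "(\<lambda>z. measure (info_kernel M (fst z) (snd z)) D) \<in> borel_measurable (step_space M)"
    unfolding step_space_def by (intro lsc_step_space_measurable kernel_open_lsc) simp
  then have "(\<lambda>z. ennreal (measure (info_kernel M (fst z) (snd z)) D)) \<in> borel_measurable (step_space M)"
    by simp
  also have "?this \<longleftrightarrow> (\<lambda>z. emeasure (info_kernel M (fst z) (snd z)) D) \<in> borel_measurable (step_space M)"
  proof (rule measurable_cong)
    fix z assume "z \<in> space (step_space M)"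
    then have "fst z \<in> info_states M" by (auto simp: step_space_def space_pair_measure space_info_borel)
    then interpret prob_space "info_kernel M (fst z) (snd z)" by (rule info_kernel_probability)
    show "ennreal (measure (info_kernel M (fst z) (snd z)) D) = emeasure (info_kernel M (fst z) (snd z)) D"
      by (simp add: emeasure_eq_measure)
  qed
  finally show "(\<lambda>z. emeasure (info_kernel M (fst z) (snd z)) D) \<in> borel_measurable (step_space M)" .
qed

text \<open>
  The value of choosing \<open>u\<close> now and paying \<open>V\<close> at the next state, known as the Q-function of \<open>V\<close>.
\<close>

definition action_value :: "('x info \<Rightarrow> real) \<Rightarrow> 'x info \<Rightarrow> 'u \<Rightarrow> real" where
  "action_value V I u = filt_cost M I u + disc M * (\<integral>I'. V I' \<partial>info_kernel M I u)"

lemma bellman_action_value: "bellman M V I = (INF u. action_value V I u)"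
  by (simp add: bellman_def action_value_def)

lemma c_nonneg: "0 \<le> c" using cost_bounded by (meson abs_ge_zero order_trans)

lemma filt_cost_bound:
  assumes "I \<in> info_states M"
  shows "\<bar>filt_cost M I u\<bar> \<le> c"
proof (cases "integrable (snd I) (\<lambda>x. cost M x u)")
  case True
  have "snd I \<in> prob_measures" using assms by (auto simp: info_states_def class_measures_def)
  then interpret prob_space "snd I" by (rule prob_measuresD)
  have "\<bar>filt_cost M I u\<bar> \<le> (\<integral>x. \<bar>cost M x u\<bar> \<partial>snd I)"
    unfolding filt_cost_def by (rule integral_abs_bound)
  also have "\<dots> \<le> (\<integral>x. c \<partial>snd I)" using True cost_bounded by (intro integral_mono) auto
  finally show ?thesis by (simp add: prob_space)
qed (simp add: filt_cost_def not_integrable_integral_eq c_nonneg)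

lemma kernel_integrable:
  fixes V :: "'x info \<Rightarrow> real"
  assumes I: "I \<in> info_states M" and V: "V \<in> borel_measurable (info_borel M)"
    and b: "\<And>J. J \<in> info_states M \<Longrightarrow> \<bar>V J\<bar> \<le> b"
  shows "integrable (info_kernel M I u) V"
proof -
  interpret prob_space "info_kernel M I u" by (rule info_kernel_probability[OF I])
  have "V \<in> borel_measurable (info_kernel M I u)"
    using V info_kernel_probability(2)[OF I] by (simp cong: measurable_cong_sets)
  then show ?thesis
    using b info_kernel_probability(3)[OF I] by (intro integrable_const_bound[of _ b] AE_I2) auto
qed

lemma kernel_integral_bound:
  fixes V :: "'x info \<Rightarrow> real"
  assumes I: "I \<in> info_states M" and V: "V \<in> borel_measurable (info_borel M)"
    and b: "\<And>J. J \<in> info_states M \<Longrightarrow> \<bar>V J\<bar> \<le> b"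
  shows "\<bar>\<integral>J. V J \<partial>info_kernel M I u\<bar> \<le> b"
proof -
  interpret prob_space "info_kernel M I u" by (rule info_kernel_probability[OF I])
  have "\<bar>\<integral>J. V J \<partial>info_kernel M I u\<bar> \<le> (\<integral>J. \<bar>V J\<bar> \<partial>info_kernel M I u)" by (rule integral_abs_bound)
  also have "\<dots> \<le> (\<integral>J. b \<partial>info_kernel M I u)"
    using b info_kernel_probability(3)[OF I] kernel_integrable[OF I V b] by (intro integral_mono) auto
  finally show ?thesis by (simp add: prob_space)
qed

lemma action_value_bound:
  fixes V :: "'x info \<Rightarrow> real"
  assumes I: "I \<in> info_states M" and V: "V \<in> borel_measurable (info_borel M)"
    and b: "\<And>J. J \<in> info_states M \<Longrightarrow> \<bar>V J\<bar> \<le> b"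
  shows "\<bar>action_value V I u\<bar> \<le> c + disc M * b"
proof -
  have "\<bar>disc M * (\<integral>J. V J \<partial>info_kernel M I u)\<bar> \<le> disc M * b"
    using kernel_integral_bound[OF assms] disc by (simp add: abs_mult)
  with filt_cost_bound[OF I, of u] show ?thesis unfolding action_value_def by linarith
qed

lemma action_value_lipschitz:
  assumes I: "I \<in> info_states M"
    and V: "V \<in> borel_measurable (info_borel M)" "\<And>J. J \<in> info_states M \<Longrightarrow> \<bar>V J\<bar> \<le> b"
    and W: "W \<in> borel_measurable (info_borel M)" "\<And>J. J \<in> info_states M \<Longrightarrow> \<bar>W J\<bar> \<le> b'"
    and d: "\<And>J. J \<in> info_states M \<Longrightarrow> \<bar>V J - W J\<bar> \<le> d"
  shows "\<bar>action_value V I u - action_value W I u\<bar> \<le> disc M * d"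
proof -
  have "action_value V I u - action_value W I u = disc M * (\<integral>J. V J - W J \<partial>info_kernel M I u)"
    using kernel_integrable[OF I V] kernel_integrable[OF I W]
    by (simp add: action_value_def algebra_simps)
  moreover have "\<bar>\<integral>J. V J - W J \<partial>info_kernel M I u\<bar> \<le> d"
    using V(1) W(1) d by (intro kernel_integral_bound[OF I]) auto
  ultimately show ?thesis using disc by (simp add: abs_mult)
qed

lemma bellman_le_action_value:
  fixes V :: "'x info \<Rightarrow> real"
  assumes I: "I \<in> info_states M" and V: "V \<in> borel_measurable (info_borel M)"
    and b: "\<And>J. J \<in> info_states M \<Longrightarrow> \<bar>V J\<bar> \<le> b"
  shows "bellman M V I \<le> action_value V I u"
  unfolding bellman_action_value
proof (rule cINF_lower)
  have "- (c + disc M * b) \<le> action_value V I u" for u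
    using action_value_bound[OF assms, of u] by linarith
  then show "bdd_below (range (action_value V I))" by (intro bdd_belowI2)
qed simp

lemma bellman_bound:
  fixes V :: "'x info \<Rightarrow> real"
  assumes I: "I \<in> info_states M" and V: "V \<in> borel_measurable (info_borel M)"
    and b: "\<And>J. J \<in> info_states M \<Longrightarrow> \<bar>V J\<bar> \<le> b"
  shows "\<bar>bellman M V I\<bar> \<le> c + disc M * b"
proof -
  have "bellman M V I \<le> c + disc M * b"
    using bellman_le_action_value[OF assms, of undefined] action_value_bound[OF assms, of undefined] by linarith
  moreover have "- (c + disc M * b) \<le> action_value V I u" for u
    using action_value_bound[OF assms, of u] by linarith
  then have "- (c + disc M * b) \<le> bellman M V I"
    unfolding bellman_action_value by (intro cINF_greatest) auto
  ultimately show ?thesis by linarith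
qed

lemma bellman_contraction:
  assumes I: "I \<in> info_states M"
    and V: "V \<in> borel_measurable (info_borel M)" "\<And>J. J \<in> info_states M \<Longrightarrow> \<bar>V J\<bar> \<le> b"
    and W: "W \<in> borel_measurable (info_borel M)" "\<And>J. J \<in> info_states M \<Longrightarrow> \<bar>W J\<bar> \<le> b'"
    and d: "\<And>J. J \<in> info_states M \<Longrightarrow> \<bar>V J - W J\<bar> \<le> d"
  shows "\<bar>bellman M V I - bellman M W I\<bar> \<le> disc M * d"
proof -
  note L = action_value_lipschitz[OF I V W d]
  have "bellman M V I - disc M * d \<le> action_value W I u" for u
    using bellman_le_action_value[OF I V, of u] L[of u] by linarith
  then have "bellman M V I - disc M * d \<le> bellman M W I"
    unfolding bellman_action_value[of W] by (intro cINF_greatest) auto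
  moreover have "bellman M W I - disc M * d \<le> action_value V I u" for u
    using bellman_le_action_value[OF I W, of u] L[of u] by linarith
  then have "bellman M W I - disc M * d \<le> bellman M V I"
    unfolding bellman_action_value[of V] by (intro cINF_greatest) auto
  ultimately show ?thesis by linarith
qed

lemma action_value_lsc:
  assumes V: "lower_semicontinuous_map (info_topology M) V"
    and b: "\<And>J. J \<in> info_states M \<Longrightarrow> \<bar>V J\<bar> \<le> b"
  shows "lower_semicontinuous_map state_action_topology (\<lambda>(I, u). action_value V I u)"
proof -
  have "lower_semicontinuous_map state_action_topology (\<lambda>z. \<integral>J. V J \<partial>info_kernel M (fst z) (snd z))"
  proof (rule lsc_integral)
    fix z assume "z \<in> topspace state_action_topology"
    then have z: "fst z \<in> info_states M" by (auto simp: topspace_info_topology)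
    show "prob_space (info_kernel M (fst z) (snd z))" by (rule info_kernel_probability[OF z])
    show "V \<in> borel_measurable (info_kernel M (fst z) (snd z))"
      using lsc_info_borel_measurable[OF V] info_kernel_probability(2)[OF z] by (simp cong: measurable_cong_sets)
    show "\<bar>V x\<bar> \<le> b" if "x \<in> space (info_kernel M (fst z) (snd z))" for x
      using that b info_kernel_probability(3)[OF z] by simp
  next
    fix t
    have "openin (info_topology M) {J \<in> info_states M. t < V J}"
      using lsc_openin[OF V] by (simp add: topspace_info_topology)
    from kernel_open_lsc[OF this] show "lower_semicontinuous_map state_action_topology
        (\<lambda>z. measure (info_kernel M (fst z) (snd z)) {x \<in> space (info_kernel M (fst z) (snd z)). t < V x})"
      by (subst lsc_cong[where g="\<lambda>z. measure (info_kernel M (fst z) (snd z)) {J \<in> info_states M. t < V J}"])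
        (auto simp: topspace_info_topology info_kernel_probability(3))
  qed
  then show ?thesis
    using cost_lsc disc unfolding action_value_def case_prod_beta by (intro lsc_add lsc_scale) auto
qed

lemma bellman_lsc:
  assumes V: "lower_semicontinuous_map (info_topology M) V"
    and b: "\<And>J. J \<in> info_states M \<Longrightarrow> \<bar>V J\<bar> \<le> b"
  shows "lower_semicontinuous_map (info_topology M) (bellman M V)"
  unfolding bellman_action_value[abs_def]
  by (rule lsc_INF_compact[OF action_value_lsc[OF assms] compact_actions]) auto

text \<open>
  Value iteration \<open>V n\<close> from \<open>0\<close> stays within the bound \<open>b = c / (1 - \<alpha>)\<close>, the solution of
  \<open>c + \<alpha> * b = b\<close>, and \<open>V (n + k)\<close> differs from \<open>V n\<close> by at most \<open>\<alpha> ^ n * b\<close>. The limit inherits lower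
  semicontinuity because the convergence is uniform.
\<close>

lemma bellman_fixed_point:
  obtains W :: "'x info \<Rightarrow> real" and b :: real where "lower_semicontinuous_map (info_topology M) W"
    "\<And>I. I \<in> info_states M \<Longrightarrow> \<bar>W I\<bar> \<le> b" "\<And>I. I \<in> info_states M \<Longrightarrow> W I = bellman M W I"
proof -
  define b where "b = c / (1 - disc M)"
  have b: "c + disc M * b = b" "0 \<le> b" using disc c_nonneg by (auto simp: b_def field_simps)
  define V where "V n = (bellman M ^^ n) (\<lambda>_. 0)" for n
  have V_simps: "V 0 = (\<lambda>_. 0)" "V (Suc n) = bellman M (V n)" for n by (simp_all add: V_def)
  have V: "lower_semicontinuous_map (info_topology M) (V n) \<and> (\<forall>I\<in>info_states M. \<bar>V n I\<bar> \<le> b)" for n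
  proof (induction n)
    case (Suc n)
    then have "\<bar>V (Suc n) I\<bar> \<le> c + disc M * b" if "I \<in> info_states M" for I
      unfolding V_simps using that by (intro bellman_bound lsc_info_borel_measurable) auto
    with Suc show ?case unfolding V_simps(2) b(1) by (auto intro: bellman_lsc)
  qed (simp add: V_simps lsc_const b)
  have Vm: "V n \<in> borel_measurable (info_borel M)" for n using V lsc_info_borel_measurable by blast
  have diff: "\<bar>V (n + k) I - V n I\<bar> \<le> disc M ^ n * b" if "I \<in> info_states M" for n k I
    using that
  proof (induction n arbitrary: I)
    case (Suc n)
    have "\<bar>bellman M (V (n + k)) I - bellman M (V n) I\<bar> \<le> disc M * (disc M ^ n * b)"
      using V Suc by (intro bellman_contraction[of _ _ b _ b] Vm) auto
    then show ?case by (simp add: V_simps mult.assoc)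
  qed (use V in \<open>simp add: V_simps\<close>)
  have small: "(\<lambda>n. disc M ^ n * b) \<longlonglongrightarrow> 0"
    using disc by (intro tendsto_mult_left_zero LIMSEQ_realpow_zero) auto
  have "convergent (\<lambda>n. V n I)" if I: "I \<in> info_states M" for I
  proof (rule Cauchy_convergent, rule metric_CauchyI)
    fix e :: real assume "e > 0"
    then obtain N where N: "disc M ^ N * b < e / 2"
      using order_tendstoD(2)[OF small, of "e / 2"] by (auto simp: eventually_sequentially)
    have "\<bar>V m I - V N I\<bar> < e / 2" if "m \<ge> N" for m
      using diff[OF I, of N "m - N"] N that by simp
    then have "dist (V m I) (V n I) < e" if "m \<ge> N" "n \<ge> N" for m n
      using that by (smt (verit) dist_real_def field_sum_of_halves)
    then show "\<exists>N. \<forall>m\<ge>N. \<forall>n\<ge>N. dist (V m I) (V n I) < e" by blast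
  qed
  define W where "W I = lim (\<lambda>n. V n I)" for I
  have lim: "(\<lambda>n. V n I) \<longlonglongrightarrow> W I" if "I \<in> info_states M" for I
    using \<open>\<And>I. I \<in> info_states M \<Longrightarrow> convergent (\<lambda>n. V n I)\<close>[OF that] unfolding W_def convergent_LIMSEQ_iff .
  have close: "\<bar>V n I - W I\<bar> \<le> disc M ^ n * b" if I: "I \<in> info_states M" for n I
  proof (rule LIMSEQ_le_const2)
    show "(\<lambda>k. \<bar>V n I - V k I\<bar>) \<longlonglongrightarrow> \<bar>V n I - W I\<bar>" by (intro tendsto_intros lim[OF I])
    have "\<bar>V n I - V k I\<bar> \<le> disc M ^ n * b" if "n \<le> k" for k
      using diff[OF I, of n "k - n"] that by (simp add: abs_minus_commute)
    then show "\<exists>N. \<forall>k\<ge>N. \<bar>V n I - V k I\<bar> \<le> disc M ^ n * b" by blast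
  qed
  have Wb: "\<bar>W I\<bar> \<le> b" if "I \<in> info_states M" for I
    using close[OF that, of 0] by (simp add: V_simps)
  have Wl: "lower_semicontinuous_map (info_topology M) W"
  proof (rule lsc_uniform_limit)
    fix e :: real assume "e > 0"
    then obtain n where "disc M ^ n * b < e"
      using order_tendstoD(2)[OF small, of e] by (auto simp: eventually_sequentially)
    with close[of _ n] V[of n]
    show "\<exists>f. lower_semicontinuous_map (info_topology M) f \<and> (\<forall>z\<in>topspace (info_topology M). \<bar>f z - W z\<bar> \<le> e)"
      by (intro exI[of _ "V n"]) (force simp: topspace_info_topology)
  qed
  have "W I = bellman M W I" if I: "I \<in> info_states M" for I
  proof -
    have "(\<lambda>n. V (Suc n) I) \<longlonglongrightarrow> bellman M W I"
    proof (rule LIM_zero_cancel, rule Lim_null_comparison)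
      have "\<bar>V (Suc n) I - bellman M W I\<bar> \<le> disc M * (disc M ^ n * b)" for n
        unfolding V_simps using V close Wb
        by (intro bellman_contraction[OF I, of _ b _ b] Vm lsc_info_borel_measurable[OF Wl]) auto
      then show "\<forall>\<^sub>F n in sequentially. norm (V (Suc n) I - bellman M W I) \<le> disc M * (disc M ^ n * b)" by simp
      show "(\<lambda>n. disc M * (disc M ^ n * b)) \<longlonglongrightarrow> 0" by (rule tendsto_mult_right_zero[OF small])
    qed
    with LIMSEQ_Suc[OF lim[OF I]] show ?thesis by (rule LIMSEQ_unique)
  qed
  with Wl Wb that show ?thesis by blast
qed

text \<open>
  Iterating the contraction estimate from the crude bound \<open>b + b'\<close> forces the difference to vanish.
\<close>

lemma bellman_unique:
  assumes V: "V \<in> borel_measurable (info_borel M)" "\<And>J. J \<in> info_states M \<Longrightarrow> \<bar>V J\<bar> \<le> b"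
      "\<And>J. J \<in> info_states M \<Longrightarrow> V J = bellman M V J"
    and W: "W \<in> borel_measurable (info_borel M)" "\<And>J. J \<in> info_states M \<Longrightarrow> \<bar>W J\<bar> \<le> b'"
      "\<And>J. J \<in> info_states M \<Longrightarrow> W J = bellman M W J"
    and I: "I \<in> info_states M"
  shows "V I = W I"
proof -
  have "\<bar>V J - W J\<bar> \<le> disc M ^ n * (b + b')" if "J \<in> info_states M" for J n
    using that
  proof (induction n arbitrary: J)
    case 0
    then show ?case using V(2)[OF 0] W(2)[OF 0] by simp
  next
    case (Suc n)
    show ?case
      using bellman_contraction[OF Suc.prems V(1,2) W(1,2) Suc.IH] V(3)[OF Suc.prems] W(3)[OF Suc.prems]
      by (simp add: mult.assoc)
  qed
  from this[OF I] have "\<exists>N. \<forall>n\<ge>N. \<bar>V I - W I\<bar> \<le> disc M ^ n * (b + b')" by blast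
  moreover have "(\<lambda>n. disc M ^ n * (b + b')) \<longlonglongrightarrow> 0"
    using disc by (intro tendsto_mult_left_zero LIMSEQ_realpow_zero) auto
  ultimately have "\<bar>V I - W I\<bar> \<le> 0" by (intro LIMSEQ_le_const)
  then show ?thesis by simp
qed

text \<open>
  The set of minimising actions meets a closed set \<open>C\<close> if and only if the minimum over \<open>C\<close> is at most the
  overall minimum. Both minima are lower semicontinuous in \<open>I\<close>, hence Borel, so the selection theorem
  applies.
\<close>

lemma bellman_selector:
  assumes V: "lower_semicontinuous_map (info_topology M) V"
    and b: "\<And>J. J \<in> info_states M \<Longrightarrow> \<bar>V J\<bar> \<le> b"
  obtains f where "f \<in> info_borel M \<rightarrow>\<^sub>M borel"
    "\<And>I. I \<in> info_states M \<Longrightarrow> action_value V I (f I) = bellman M V I"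
proof -
  note Q = action_value_lsc[OF assms]
  have sec: "lower_semicontinuous_map euclidean (action_value V I)" if "I \<in> info_states M" for I
    using lsc_section[OF Q] that by (simp add: topspace_info_topology)
  have le: "bellman M V I \<le> action_value V I u" if "I \<in> info_states M" for I u
    using bellman_le_action_value[OF that lsc_info_borel_measurable[OF V] b] .
  define A where "A I = {u. action_value V I u \<le> bellman M V I}" for I
  have min: "(\<exists>u\<in>C. action_value V I u \<le> bellman M V I) \<longleftrightarrow> (INF u\<in>C. action_value V I u) \<le> bellman M V I"
    if I: "I \<in> info_states M" and C: "closed C" "C \<noteq> {}" for I C
  proof -
    have "compact C" using compact_Int_closed[OF compact_actions C(1)] by simp
    then obtain u where u: "u \<in> C" "\<And>w. w \<in> C \<Longrightarrow> action_value V I u \<le> action_value V I w"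
      using lsc_attains_min_on_compact[OF sec[OF I] _ C(2)] by blast
    then have "(INF u\<in>C. action_value V I u) = action_value V I u" by (intro cInf_eq_minimum) auto
    with u show ?thesis by (auto intro: order_trans)
  qed
  have A_closed: "closed (A I)" if "I \<in> space (info_borel M)" for I
  proof -
    have "open {u. bellman M V I < action_value V I u}"
      using lsc_openin[OF sec, of I "bellman M V I"] that by (simp add: space_info_borel)
    then show ?thesis by (simp add: A_def closed_def Compl_eq not_le)
  qed
  have A_nonempty: "A I \<noteq> {}" if "I \<in> space (info_borel M)" for I
    using min[of I UNIV] that by (auto simp: A_def space_info_borel bellman_action_value)
  have A_hits: "{I \<in> space (info_borel M). A I \<inter> C \<noteq> {}} \<in> sets (info_borel M)" if C: "closed C" for C
  proof (cases "C = {}")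
    case False
    have [measurable]: "(\<lambda>I. INF u\<in>C. action_value V I u) \<in> borel_measurable (info_borel M)"
      by (rule lsc_info_borel_measurable[OF lsc_INF_compact[OF Q compact_actions C False]])
    have [measurable]: "bellman M V \<in> borel_measurable (info_borel M)"
      by (rule lsc_info_borel_measurable[OF bellman_lsc[OF assms]])
    have "{I \<in> space (info_borel M). A I \<inter> C \<noteq> {}} =
        {I \<in> space (info_borel M). (INF u\<in>C. action_value V I u) \<le> bellman M V I}"
      using min[OF _ C False] by (auto simp: A_def space_info_borel)
    then show ?thesis by simp
  qed simp
  obtain f where f: "f \<in> info_borel M \<rightarrow>\<^sub>M borel" "\<And>I. I \<in> space (info_borel M) \<Longrightarrow> f I \<in> A I"
    using measurable_selection[OF A_closed A_nonempty A_hits] by blast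
  have "action_value V I (f I) = bellman M V I" if "I \<in> info_states M" for I
    using f(2)[of I] le[OF that, of "f I"] that by (simp add: A_def space_info_borel)
  with f(1) that show ?thesis by blast
qed

section \<open>The law of the controlled process\<close>

abbreviation history_space :: "nat \<Rightarrow> (nat \<Rightarrow> 'x info \<times> 'u) measure"
  where "history_space t \<equiv> PiM {0..<t} (\<lambda>_. step_space M)"

text \<open>
  The conditional law of \<open>I\<^sub>t\<close> given the history, that is, the step law before the action is drawn.
\<close>

definition state_law :: "'x info \<Rightarrow> nat \<Rightarrow> (nat \<Rightarrow> 'x info \<times> 'u) \<Rightarrow> 'x info measure" where
  "state_law I t h = (if t = 0 then return (info_borel M) I else info_kernel M (fst (h (t - 1))) (snd (h (t - 1))))"

lemma step_law_state_law:
  "step_law M \<gamma> I t h = state_law I t h \<bind> (\<lambda>I'. \<gamma> t (h, I') \<bind> (\<lambda>u. return (step_space M) (I', u)))"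
  by (simp add: step_law_def state_law_def)

lemma space_step_space: "space (step_space M) = info_states M \<times> UNIV"
  by (simp add: step_space_def space_pair_measure space_info_borel)

lemma fst_step_space [measurable]: "fst \<in> step_space M \<rightarrow>\<^sub>M info_borel M"
  and snd_step_space [measurable]: "snd \<in> step_space M \<rightarrow>\<^sub>M borel"
  by (simp_all add: step_space_def)

lemma state_law_measurable:
  assumes I: "I \<in> info_states M"
  shows "state_law I t \<in> history_space t \<rightarrow>\<^sub>M prob_algebra (info_borel M)"
proof (cases t)
  case 0
  have "return (info_borel M) I \<in> space (prob_algebra (info_borel M))"
    using I by (intro measurable_space[OF measurable_return_prob_space]) (simp add: space_info_borel)
  then show ?thesis using 0 by (simp add: state_law_def[abs_def])
next
  case (Suc n)
  have "(\<lambda>h. h n) \<in> history_space t \<rightarrow>\<^sub>M step_space M"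
    using Suc by (intro measurable_component_singleton) simp
  from measurable_compose[OF this info_kernel_measurable] show ?thesis
    using Suc by (simp add: state_law_def[abs_def])
qed

lemma action_law_measurable:
  assumes \<gamma>: "\<gamma> \<in> policies M"
  shows "(\<lambda>(h, I'). \<gamma> t (h, I') \<bind> (\<lambda>u. return (step_space M) (I', u)))
    \<in> history_space t \<Otimes>\<^sub>M info_borel M \<rightarrow>\<^sub>M prob_algebra (step_space M)"
proof -
  have g: "\<gamma> t \<in> history_space t \<Otimes>\<^sub>M info_borel M \<rightarrow>\<^sub>M prob_algebra borel"
    using \<gamma> by (simp add: policies_def)
  have "(\<lambda>p. \<gamma> t p \<bind> (\<lambda>u. return (step_space M) (snd p, u)))
    \<in> history_space t \<Otimes>\<^sub>M info_borel M \<rightarrow>\<^sub>M prob_algebra (step_space M)"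
  proof (rule measurable_bind_prob_space2[OF g])
    have "(\<lambda>q. (snd (fst q), snd q)) \<in> (history_space t \<Otimes>\<^sub>M info_borel M) \<Otimes>\<^sub>M borel \<rightarrow>\<^sub>M step_space M"
      unfolding step_space_def by measurable
    from measurable_compose[OF this measurable_return_prob_space]
    show "(\<lambda>(p, u). return (step_space M) (snd p, u))
        \<in> (history_space t \<Otimes>\<^sub>M info_borel M) \<Otimes>\<^sub>M borel \<rightarrow>\<^sub>M prob_algebra (step_space M)"
      by (simp add: case_prod_beta)
  qed
  then show ?thesis by (simp add: case_prod_unfold)
qed

lemma step_law_measurable:
  assumes \<gamma>: "\<gamma> \<in> policies M" and I: "I \<in> info_states M"
  shows "step_law M \<gamma> I t \<in> history_space t \<rightarrow>\<^sub>M prob_algebra (step_space M)"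
  unfolding step_law_state_law[abs_def]
  by (rule measurable_bind_prob_space2[OF state_law_measurable[OF I] action_law_measurable[OF \<gamma>]])

lemma action_law_section:
  assumes \<gamma>: "\<gamma> \<in> policies M" and h: "h \<in> space (history_space t)"
  shows "(\<lambda>I'. \<gamma> t (h, I') \<bind> (\<lambda>u. return (step_space M) (I', u))) \<in> info_borel M \<rightarrow>\<^sub>M prob_algebra (step_space M)"
  using measurable_compose[OF measurable_Pair1'[OF h] action_law_measurable[OF \<gamma>]] by simp

lemma state_law_probability:
  assumes I: "I \<in> info_states M" and h: "h \<in> space (history_space t)"
  shows "prob_space (state_law I t h)" "sets (state_law I t h) = sets (info_borel M)"
    "space (state_law I t h) = info_states M"
  using measurable_space[OF state_law_measurable[OF I] h]
    sets_eq_imp_space_eq[of "state_law I t h" "info_borel M"]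
  by (auto simp: space_prob_algebra space_info_borel)

text \<open>
  Drawing the action leaves the state untouched. This is why the state marginals obey the same dynamics
  under every policy.
\<close>

lemma distr_step_law_fst:
  assumes \<gamma>: "\<gamma> \<in> policies M" and I: "I \<in> info_states M" and h: "h \<in> space (history_space t)"
  shows "distr (step_law M \<gamma> I t h) (info_borel M) fst = state_law I t h"
proof -
  note S = state_law_probability[OF I h]
  have ne: "space (state_law I t h) \<noteq> {}" using prob_space.not_empty[OF S(1)] .
  have "distr (step_law M \<gamma> I t h) (info_borel M) fst =
      state_law I t h \<bind> (\<lambda>I'. distr (\<gamma> t (h, I') \<bind> (\<lambda>u. return (step_space M) (I', u))) (info_borel M) fst)"
    unfolding step_law_state_law
    using measurable_prob_algebraD[OF action_law_section[OF \<gamma> h]] S(2)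
    by (intro distr_bind[OF _ ne fst_step_space]) (simp cong: measurable_cong_sets)
  also have "\<dots> = state_law I t h \<bind> return (info_borel M)"
  proof (rule bind_cong[OF refl])
    fix I' assume "I' \<in> space (state_law I t h)"
    then have I': "I' \<in> info_states M" by (simp add: S(3))
    have "\<gamma> t (h, I') \<in> space (prob_algebra borel)"
      using \<gamma> h I' by (intro measurable_space[of "\<gamma> t" "history_space t \<Otimes>\<^sub>M info_borel M"])
        (auto simp: policies_def space_pair_measure space_info_borel)
    then have g: "prob_space (\<gamma> t (h, I'))" "sets (\<gamma> t (h, I')) = sets borel" by (auto simp: space_prob_algebra)
    have "(\<lambda>u. (I', u)) \<in> borel \<rightarrow>\<^sub>M step_space M"
      unfolding step_space_def using I' by (intro measurable_Pair1') (simp add: space_info_borel)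
    then have m: "(\<lambda>u. (I', u)) \<in> \<gamma> t (h, I') \<rightarrow>\<^sub>M step_space M" using g(2) by (simp cong: measurable_cong_sets)
    have "distr (\<gamma> t (h, I') \<bind> (\<lambda>u. return (step_space M) (I', u))) (info_borel M) fst =
        distr (distr (\<gamma> t (h, I')) (step_space M) (\<lambda>u. (I', u))) (info_borel M) fst"
      using bind_return_distr'[OF prob_space.not_empty[OF g(1)] m] by simp
    also have "\<dots> = distr (\<gamma> t (h, I')) (info_borel M) (\<lambda>_. I')"
      by (subst distr_distr[OF fst_step_space m]) (simp add: comp_def)
    also have "\<dots> = return (info_borel M) I'"
      using I' by (intro prob_space.distr_const[OF g(1)]) (simp add: space_info_borel)
    finally show "distr (\<gamma> t (h, I') \<bind> (\<lambda>u. return (step_space M) (I', u))) (info_borel M) fst = return (info_borel M) I'" .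
  qed
  also have "\<dots> = state_law I t h" by (rule bind_return''[OF S(2)])
  finally show ?thesis .
qed

definition marginal :: "('x, 'u) policy \<Rightarrow> 'x info \<Rightarrow> nat \<Rightarrow> ('x info \<times> 'u) measure" where
  "marginal \<gamma> I t = distr (traj_law M \<gamma> I) (step_space M) (\<lambda>\<omega>. \<omega> t)"

lemma Ionescu_Tulcea_step_law:
  assumes "\<gamma> \<in> policies M" "I \<in> info_states M"
  shows "Ionescu_Tulcea (step_law M \<gamma> I) (\<lambda>_. step_space M)"
proof (rule Ionescu_Tulcea.intro)
  fix t
  show "step_law M \<gamma> I t \<in> history_space t \<rightarrow>\<^sub>M subprob_algebra (step_space M)"
    by (rule measurable_prob_algebraD[OF step_law_measurable[OF assms]])
  fix h assume "h \<in> space (history_space t)"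
  from measurable_space[OF step_law_measurable[OF assms] this]
  show "prob_space (step_law M \<gamma> I t h)" by (simp add: space_prob_algebra)
qed

lemma traj_law_prob:
  assumes "\<gamma> \<in> policies M" "I \<in> info_states M"
  shows "prob_space (traj_law M \<gamma> I)" "sets (traj_law M \<gamma> I) = sets (PiM UNIV (\<lambda>_. step_space M))"
proof -
  interpret IT: Ionescu_Tulcea "step_law M \<gamma> I" "\<lambda>_. step_space M"
    by (rule Ionescu_Tulcea_step_law[OF assms])
  show s: "sets (traj_law M \<gamma> I) = sets (PiM UNIV (\<lambda>_. step_space M))"
    unfolding traj_law_def by (rule IT.PF.sets_lim)
  have "prob_space (IT.CI {})" by (rule IT.PF.prob_space_P) auto
  then have "prob_space (distr (traj_law M \<gamma> I) (PiM {} (\<lambda>_. step_space M)) (\<lambda>x. restrict x {}))"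
    unfolding traj_law_def by (subst IT.distr_lim) auto
  then show "prob_space (traj_law M \<gamma> I)"
    by (rule prob_space_distrD[rotated]) (unfold measurable_cong_sets[OF s refl], rule measurable_restrict_subset, simp)
qed

text \<open>
  The law of the first \<open>t\<close> state-action pairs in the Ionescu-Tulcea construction. It starts from
  \<open>\<lambda>_. undefined\<close>, the only element of the empty product, which stands for the empty history.
\<close>

definition history_law :: "('x, 'u) policy \<Rightarrow> 'x info \<Rightarrow> nat \<Rightarrow> (nat \<Rightarrow> 'x info \<times> 'u) measure" where
  "history_law \<gamma> I t = Ionescu_Tulcea.C (step_law M \<gamma> I) (\<lambda>_. step_space M) 0 t (\<lambda>_. undefined)"

lemma history_law_prob:
  assumes "\<gamma> \<in> policies M" "I \<in> info_states M"
  shows "prob_space (history_law \<gamma> I t)" "sets (history_law \<gamma> I t) = sets (history_space t)"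
    "space (history_law \<gamma> I t) = space (history_space t)"
proof -
  interpret IT: Ionescu_Tulcea "step_law M \<gamma> I" "\<lambda>_. step_space M"
    by (rule Ionescu_Tulcea_step_law[OF assms])
  have u: "(\<lambda>_. undefined) \<in> space (history_space 0)" by (auto simp: space_PiM)
  show "prob_space (history_law \<gamma> I t)" "sets (history_law \<gamma> I t) = sets (history_space t)"
    "space (history_law \<gamma> I t) = space (history_space t)"
    using IT.prob_space_C[OF u, of t] IT.sets_C[OF u, of t] IT.space_C[OF u, of t]
    by (simp_all add: history_law_def)
qed

text \<open>
  The law of the whole trajectory is the projective limit of the history laws, so a single coordinate can
  be read off from any sufficiently long history.
\<close>

lemma marginal_eq_coordinate:
  assumes "\<gamma> \<in> policies M" "I \<in> info_states M"
  shows "marginal \<gamma> I t = distr (history_law \<gamma> I (Suc t)) (step_space M) (\<lambda>h. h t)"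
proof -
  interpret IT: Ionescu_Tulcea "step_law M \<gamma> I" "\<lambda>_. step_space M"
    by (rule Ionescu_Tulcea_step_law[OF assms])
  have up: "IT.up_to {0..<n} = n" for n
  proof (rule antisym)
    show "IT.up_to {0..<n} \<le> n" by (simp add: IT.up_to_iff_Ico)
    show "n \<le> IT.up_to {0..<n}"
      using IT.up_to_less[of "{0..<n}" "n - 1"] by (cases n) auto
  qed
  have comp: "(\<lambda>h. h t) \<in> history_space (Suc t) \<rightarrow>\<^sub>M step_space M"
    by (intro measurable_component_singleton) simp
  let ?J = "{0..<Suc t}"
  have r: "(\<lambda>\<omega>. restrict \<omega> ?J) \<in> traj_law M \<gamma> I \<rightarrow>\<^sub>M history_space (Suc t)"
    unfolding measurable_cong_sets[OF traj_law_prob(2)[OF assms] refl] by (rule measurable_restrict_subset) simp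
  have r': "(\<lambda>\<omega>. restrict \<omega> ?J) \<in> history_law \<gamma> I (Suc t) \<rightarrow>\<^sub>M history_space (Suc t)"
    unfolding measurable_cong_sets[OF history_law_prob(2)[OF assms] refl] by (rule measurable_restrict_subset) simp
  have "marginal \<gamma> I t = distr (distr (traj_law M \<gamma> I) (history_space (Suc t)) (\<lambda>\<omega>. restrict \<omega> ?J)) (step_space M) (\<lambda>h. h t)"
    unfolding marginal_def by (subst distr_distr[OF comp r]) (simp add: comp_def)
  also have "distr (traj_law M \<gamma> I) (history_space (Suc t)) (\<lambda>\<omega>. restrict \<omega> ?J) = IT.CI ?J"
    unfolding traj_law_def by (rule IT.distr_lim) simp
  also have "IT.CI ?J = distr (history_law \<gamma> I (Suc t)) (history_space (Suc t)) (\<lambda>\<omega>. restrict \<omega> ?J)"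
    unfolding IT.CI_def up history_law_def ..
  also have "distr \<dots> (step_space M) (\<lambda>h. h t) = distr (history_law \<gamma> I (Suc t)) (step_space M) (\<lambda>h. h t)"
    by (subst distr_distr[OF comp r']) (simp add: comp_def)
  finally show ?thesis .
qed

lemma marginal_eq_bind:
  assumes "\<gamma> \<in> policies M" "I \<in> info_states M"
  shows "marginal \<gamma> I t = history_law \<gamma> I t \<bind> step_law M \<gamma> I t"
proof -
  interpret IT: Ionescu_Tulcea "step_law M \<gamma> I" "\<lambda>_. step_space M"
    by (rule Ionescu_Tulcea_step_law[OF assms])
  have comp: "(\<lambda>h. h t) \<in> history_space (Suc t) \<rightarrow>\<^sub>M step_space M"
    by (intro measurable_component_singleton) simp
  have "marginal \<gamma> I t = distr (history_law \<gamma> I t \<bind> IT.eP t) (step_space M) (\<lambda>h. h t)"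
    unfolding marginal_eq_coordinate[OF assms] by (simp add: history_law_def)
  also have "\<dots> = history_law \<gamma> I t \<bind> (\<lambda>h. distr (IT.eP t h) (step_space M) (\<lambda>h. h t))"
    using IT.measurable_eP[of t]
    by (intro distr_bind[OF _ prob_space.not_empty[OF history_law_prob(1)[OF assms]] comp]) (simp add: measurable_cong_sets[OF history_law_prob(2)[OF assms] refl])
  also have "\<dots> = history_law \<gamma> I t \<bind> step_law M \<gamma> I t"
  proof (rule bind_cong[OF refl])
    fix h assume "h \<in> space (history_law \<gamma> I t)"
    then have h: "h \<in> space (history_space t)" using sets_eq_imp_space_eq[OF history_law_prob(2)[OF assms]] by blast
    have s: "sets (step_law M \<gamma> I t h) = sets (step_space M)" by (rule IT.sets_P[OF h])
    have upd: "fun_upd h t \<in> step_law M \<gamma> I t h \<rightarrow>\<^sub>M history_space (Suc t)"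
      using h by (simp add: measurable_cong_sets[OF s refl], intro measurable_fun_upd[where J="{0..<t}"]) auto
    have "distr (IT.eP t h) (step_space M) (\<lambda>h. h t) = distr (step_law M \<gamma> I t h) (step_space M) (\<lambda>z. z)"
      unfolding IT.eP_def by (subst distr_distr[OF comp upd]) (simp add: comp_def)
    also have "\<dots> = step_law M \<gamma> I t h" by (rule distr_id2[OF s[symmetric]])
    finally show "distr (IT.eP t h) (step_space M) (\<lambda>h. h t) = step_law M \<gamma> I t h" .
  qed
  finally show ?thesis .
qed

lemma marginal_prob:
  assumes "\<gamma> \<in> policies M" "I \<in> info_states M"
  shows "prob_space (marginal \<gamma> I t)" "sets (marginal \<gamma> I t) = sets (step_space M)"
    "space (marginal \<gamma> I t) = info_states M \<times> UNIV"
proof -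
  have "(\<lambda>\<omega>. \<omega> t) \<in> traj_law M \<gamma> I \<rightarrow>\<^sub>M step_space M"
    by (simp add: measurable_cong_sets[OF traj_law_prob(2)[OF assms] refl])
  then show "prob_space (marginal \<gamma> I t)"
    unfolding marginal_def by (intro prob_space.prob_space_distr traj_law_prob assms)
qed (simp_all add: marginal_def space_step_space)

text \<open>
  The controlled Markov property, in the only form that the comparison of costs requires: the next
  state is distributed according to the kernel applied to the current state-action pair, whatever the
  policy does.
\<close>

lemma marginal_state:
  assumes \<gamma>: "\<gamma> \<in> policies M" and I: "I \<in> info_states M"
  shows "distr (marginal \<gamma> I 0) (info_borel M) fst = return (info_borel M) I"
    "distr (marginal \<gamma> I (Suc t)) (info_borel M) fst = marginal \<gamma> I t \<bind> (\<lambda>z. info_kernel M (fst z) (snd z))"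
proof -
  note Hp = history_law_prob[OF assms]
  note ne = prob_space.not_empty[OF Hp(1)]
  have state: "distr (marginal \<gamma> I t) (info_borel M) fst = history_law \<gamma> I t \<bind> state_law I t" for t
  proof -
    have "distr (marginal \<gamma> I t) (info_borel M) fst = history_law \<gamma> I t \<bind> (\<lambda>h. distr (step_law M \<gamma> I t h) (info_borel M) fst)"
      unfolding marginal_eq_bind[OF assms] using measurable_prob_algebraD[OF step_law_measurable[OF assms, of t]]
      by (intro distr_bind[OF _ ne fst_step_space]) (simp add: measurable_cong_sets[OF Hp(2) refl])
    also have "\<dots> = history_law \<gamma> I t \<bind> state_law I t"
      using Hp(3) by (intro bind_cong[OF refl] distr_step_law_fst assms) simp
    finally show ?thesis .
  qed
  have "distr (marginal \<gamma> I 0) (info_borel M) fst = history_law \<gamma> I 0 \<bind> (\<lambda>_. return (info_borel M) I)"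
    unfolding state by (simp add: state_law_def[abs_def])
  also have "\<dots> = return (info_borel M) I"
    using I by (intro bind_const' Hp prob_space_imp_subprob_space prob_space_return) (simp add: space_info_borel)
  finally show "distr (marginal \<gamma> I 0) (info_borel M) fst = return (info_borel M) I" .
  have "(\<lambda>h. h t) \<in> history_law \<gamma> I (Suc t) \<rightarrow>\<^sub>M step_space M"
    by (simp add: measurable_cong_sets[OF Hp(2) refl])
  from bind_distr[OF this measurable_prob_algebraD[OF info_kernel_measurable] ne]
  show "distr (marginal \<gamma> I (Suc t)) (info_borel M) fst = marginal \<gamma> I t \<bind> (\<lambda>z. info_kernel M (fst z) (snd z))"
    unfolding state unfolding marginal_eq_coordinate[OF assms] by (simp add: state_law_def[abs_def])
qed

lemma marginal_state_integral:
  assumes \<gamma>: "\<gamma> \<in> policies M" and I: "I \<in> info_states M"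
    and W: "W \<in> borel_measurable (info_borel M)" and b: "\<And>J. J \<in> info_states M \<Longrightarrow> \<bar>W J :: real\<bar> \<le> b"
  shows "(\<integral>z. W (fst z) \<partial>marginal \<gamma> I 0) = W I"
    "(\<integral>z. W (fst z) \<partial>marginal \<gamma> I (Suc t)) = (\<integral>z. (\<integral>J. W J \<partial>info_kernel M (fst z) (snd z)) \<partial>marginal \<gamma> I t)"
proof -
  note mp = marginal_prob[OF \<gamma> I]
  have fst: "fst \<in> marginal \<gamma> I t \<rightarrow>\<^sub>M info_borel M" for t
    using fst_step_space by (simp add: measurable_cong_sets[OF mp(2) refl])
  have tr: "(\<integral>z. W (fst z) \<partial>marginal \<gamma> I t) = (\<integral>J. W J \<partial>distr (marginal \<gamma> I t) (info_borel M) fst)" for t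
    by (rule integral_distr[OF fst W, symmetric])
  show "(\<integral>z. W (fst z) \<partial>marginal \<gamma> I 0) = W I"
    unfolding tr marginal_state(1)[OF \<gamma> I] using I W by (intro integral_return) (simp_all add: space_info_borel)
  show "(\<integral>z. W (fst z) \<partial>marginal \<gamma> I (Suc t)) = (\<integral>z. (\<integral>J. W J \<partial>info_kernel M (fst z) (snd z)) \<partial>marginal \<gamma> I t)"
    unfolding tr marginal_state(2)[OF \<gamma> I]
  proof (rule integral_bind[where K="info_borel M" and B=b and B'=1])
    show "(\<lambda>z. info_kernel M (fst z) (snd z)) \<in> marginal \<gamma> I t \<rightarrow>\<^sub>M subprob_algebra (info_borel M)"
      using measurable_prob_algebraD[OF info_kernel_measurable] by (simp add: measurable_cong_sets[OF mp(2) refl])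
    show "finite_measure (marginal \<gamma> I t)" using mp(1) by (rule prob_space.finite_measure)
    show "AE z in marginal \<gamma> I t. emeasure (info_kernel M (fst z) (snd z)) (space (info_kernel M (fst z) (snd z))) \<le> ennreal 1"
      using prob_space.emeasure_space_1[OF info_kernel_probability(1)] mp(3) by (intro AE_I2) auto
  qed (use W b in \<open>auto simp: space_info_borel\<close>)
qed

section \<open>Comparing policy costs with a value function\<close>

lemma filt_cost_measurable: "(\<lambda>z. filt_cost M (fst z) (snd z)) \<in> borel_measurable (step_space M)"
  using lsc_step_space_measurable[OF cost_lsc] by (simp add: step_space_def case_prod_beta)

lemma marginal_integrable:
  assumes "\<gamma> \<in> policies M" "I \<in> info_states M" and F: "F \<in> borel_measurable (step_space M)"
    and b: "\<And>z. z \<in> info_states M \<times> UNIV \<Longrightarrow> \<bar>F z :: real\<bar> \<le> b"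
  shows "integrable (marginal \<gamma> I t) F"
proof -
  interpret prob_space "marginal \<gamma> I t" by (rule marginal_prob[OF assms(1,2)])
  show ?thesis
    using F b marginal_prob[OF assms(1,2)]
    by (intro integrable_const_bound[of _ b] AE_I2) (auto simp: measurable_cong_sets[OF marginal_prob(2)[OF assms(1,2)] refl])
qed

text \<open>
  Costs are bounded and discounted, so the sum over time can be interchanged with the expectation.
\<close>

lemma policy_cost_sums:
  assumes \<gamma>: "\<gamma> \<in> policies M" and I: "I \<in> info_states M"
  shows "(\<lambda>t. disc M ^ t * (\<integral>z. filt_cost M (fst z) (snd z) \<partial>marginal \<gamma> I t)) sums policy_cost M \<gamma> I"
proof -
  let ?T = "traj_law M \<gamma> I" and ?g = "\<lambda>z. filt_cost M (fst z) (snd z)"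
  interpret prob_space ?T by (rule traj_law_prob[OF assms])
  have comp: "(\<lambda>\<omega>. \<omega> t) \<in> ?T \<rightarrow>\<^sub>M step_space M" for t
    by (simp add: measurable_cong_sets[OF traj_law_prob(2)[OF assms] refl])
  have gm: "(\<lambda>\<omega>. ?g (\<omega> t)) \<in> borel_measurable ?T" for t
    by (rule measurable_compose[OF comp filt_cost_measurable])
  have gb: "\<bar>?g (\<omega> t)\<bar> \<le> c" if "\<omega> \<in> space ?T" for \<omega> t
    using measurable_space[OF comp that, of t] by (intro filt_cost_bound) (simp add: space_step_space mem_Times_iff)
  have i: "integrable ?T (\<lambda>\<omega>. disc M ^ t * ?g (\<omega> t))" for t
    using gm gb by (intro integrable_mult_right integrable_const_bound[of _ c]) auto
  have geo: "summable (\<lambda>t. disc M ^ t * c)" using disc by (intro summable_mult2 summable_geometric) auto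
  have nb: "norm (disc M ^ t * ?g (\<omega> t)) \<le> disc M ^ t * c" if "\<omega> \<in> space ?T" for \<omega> t
    using gb[OF that, of t] disc by (simp add: abs_mult mult_left_mono)
  have "(\<lambda>t. \<integral>\<omega>. disc M ^ t * ?g (\<omega> t) \<partial>?T) sums (\<integral>\<omega>. (\<Sum>t. disc M ^ t * ?g (\<omega> t)) \<partial>?T)"
  proof (rule sums_integral)
    show "AE \<omega> in ?T. summable (\<lambda>t. norm (disc M ^ t * ?g (\<omega> t)))"
      using nb by (intro AE_I2 summable_comparison_test'[OF geo]) auto
    have "norm (\<integral>\<omega>. norm (disc M ^ t * ?g (\<omega> t)) \<partial>?T) \<le> disc M ^ t * c" for t
    proof -
      have "(\<integral>\<omega>. norm (disc M ^ t * ?g (\<omega> t)) \<partial>?T) \<le> (\<integral>\<omega>. disc M ^ t * c \<partial>?T)"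
        using i nb by (intro integral_mono integrable_norm) auto
      then show ?thesis by (simp add: prob_space)
    qed
    then show "summable (\<lambda>t. \<integral>\<omega>. norm (disc M ^ t * ?g (\<omega> t)) \<partial>?T)"
      by (intro summable_comparison_test'[OF geo]) auto
  qed (rule i)
  moreover have "(\<integral>\<omega>. ?g (\<omega> t) \<partial>?T) = (\<integral>z. ?g z \<partial>marginal \<gamma> I t)" for t
    unfolding marginal_def by (rule integral_distr[OF comp filt_cost_measurable, symmetric])
  ultimately show ?thesis by (simp add: policy_cost_def)
qed

text \<open>
  With \<open>a t = E[g(I\<^sub>t, U\<^sub>t)]\<close> and \<open>w t = E[W(I\<^sub>t)]\<close>, the Markov property turns the expectation on the left
  into \<open>a t + \<alpha> * w (t + 1) - w t\<close>. After discounting, the \<open>w\<close> terms telescope and leave \<open>- w 0 = - W I\<close>.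
\<close>

lemma policy_cost_decomposition:
  fixes W :: "'x info \<Rightarrow> real"
  assumes \<gamma>: "\<gamma> \<in> policies M" and I: "I \<in> info_states M"
    and W: "W \<in> borel_measurable (info_borel M)" and b: "\<And>J. J \<in> info_states M \<Longrightarrow> \<bar>W J\<bar> \<le> b"
  shows "(\<lambda>t. disc M ^ t * (\<integral>z. action_value W (fst z) (snd z) - W (fst z) \<partial>marginal \<gamma> I t)) sums
    (policy_cost M \<gamma> I - W I)"
proof -
  note int = marginal_integrable[OF \<gamma> I]
  define a where "a t = (\<integral>z. filt_cost M (fst z) (snd z) \<partial>marginal \<gamma> I t)" for t
  define w where "w t = (\<integral>z. W (fst z) \<partial>marginal \<gamma> I t)" for t
  have iW: "integrable (marginal \<gamma> I t) (\<lambda>z. W (fst z))" for t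
    by (rule int[of _ b]) (use b measurable_compose[OF fst_step_space W] in auto)
  have ig: "integrable (marginal \<gamma> I t) (\<lambda>z. filt_cost M (fst z) (snd z))" for t
    by (rule int[of _ c]) (use filt_cost_bound filt_cost_measurable in auto)
  have iK: "integrable (marginal \<gamma> I t) (\<lambda>z. \<integral>J. W J \<partial>info_kernel M (fst z) (snd z))" for t
  proof (rule int[of _ b])
    show "(\<lambda>z. \<integral>J. W J \<partial>info_kernel M (fst z) (snd z)) \<in> borel_measurable (step_space M)"
      by (rule measurable_compose[OF measurable_prob_algebraD[OF info_kernel_measurable]
            integral_measurable_subprob_algebra[OF W]])
  qed (use kernel_integral_bound[OF _ W b] in auto)
  have d: "(\<integral>z. action_value W (fst z) (snd z) - W (fst z) \<partial>marginal \<gamma> I t) = a t + disc M * w (Suc t) - w t" for t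
  proof -
    have "w (Suc t) = (\<integral>z. (\<integral>J. W J \<partial>info_kernel M (fst z) (snd z)) \<partial>marginal \<gamma> I t)"
      unfolding w_def by (rule marginal_state_integral(2)[OF \<gamma> I W b])
    then show ?thesis
      using iW ig iK by (simp add: action_value_def a_def w_def)
  qed
  have "\<bar>w t\<bar> \<le> b" for t
  proof -
    interpret prob_space "marginal \<gamma> I t" by (rule marginal_prob[OF \<gamma> I])
    have "\<bar>w t\<bar> \<le> (\<integral>z. \<bar>W (fst z)\<bar> \<partial>marginal \<gamma> I t)" unfolding w_def by (rule integral_abs_bound)
    also have "\<dots> \<le> (\<integral>z. b \<partial>marginal \<gamma> I t)"
      using iW b marginal_prob(3)[OF \<gamma> I] by (intro integral_mono) auto
    finally show ?thesis by (simp add: prob_space)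
  qed
  then have "norm (disc M ^ t * w t) \<le> disc M ^ t * b" for t
    using disc by (simp add: abs_mult mult_left_mono)
  then have "\<forall>\<^sub>F t in sequentially. norm (disc M ^ t * w t) \<le> disc M ^ t * b"
    by (intro always_eventually allI)
  moreover have "(\<lambda>t. disc M ^ t * b) \<longlonglongrightarrow> 0"
    using disc by (intro tendsto_mult_left_zero LIMSEQ_realpow_zero) auto
  ultimately have "(\<lambda>t. disc M ^ t * w t) \<longlonglongrightarrow> 0" by (rule Lim_null_comparison)
  from telescope_sums[OF this]
  have tele: "(\<lambda>t. disc M ^ Suc t * w (Suc t) - disc M ^ t * w t) sums (0 - disc M ^ 0 * w 0)" .
  have "w 0 = W I" unfolding w_def by (rule marginal_state_integral(1)[OF \<gamma> I W b])
  with sums_add[OF policy_cost_sums[OF \<gamma> I] tele] show ?thesis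
    unfolding d by (simp add: a_def algebra_simps)
qed

text \<open>
  Every term of the decomposition is nonnegative as soon as \<open>W\<close> lies below its own Bellman image.
\<close>

lemma policy_cost_ge:
  assumes \<gamma>: "\<gamma> \<in> policies M" and I: "I \<in> info_states M"
    and W: "W \<in> borel_measurable (info_borel M)" and b: "\<And>J. J \<in> info_states M \<Longrightarrow> \<bar>W J\<bar> \<le> b"
    and sub: "\<And>J. J \<in> info_states M \<Longrightarrow> W J \<le> bellman M W J"
  shows "W I \<le> policy_cost M \<gamma> I"
proof -
  have "W J \<le> action_value W J u" if "J \<in> info_states M" for J u
    using sub[OF that] bellman_le_action_value[OF that W b, of u] by linarith
  then have "0 \<le> (\<integral>z. action_value W (fst z) (snd z) - W (fst z) \<partial>marginal \<gamma> I t)" for t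
    using marginal_prob(3)[OF \<gamma> I] by (intro integral_nonneg_AE AE_I2) auto
  then have "0 \<le> policy_cost M \<gamma> I - W I"
    using disc by (intro sums_le[OF _ sums_zero policy_cost_decomposition[OF \<gamma> I W b]]) auto
  then show ?thesis by simp
qed

lemma stationary_policy:
  assumes f: "f \<in> info_borel M \<rightarrow>\<^sub>M borel"
  shows "stationary f \<in> policies M"
  unfolding policies_def stationary_def[abs_def] case_prod_beta
  by (auto intro!: measurable_compose[OF _ measurable_return_prob_space] measurable_compose[OF measurable_snd f])

text \<open>
  Under the stationary policy the pair \<open>(I\<^sub>t, U\<^sub>t)\<close> lies almost surely on the graph of \<open>f\<close>, where the
  terms of the decomposition are zero.
\<close>

lemma stationary_policy_cost:
  assumes f: "f \<in> info_borel M \<rightarrow>\<^sub>M borel" and I: "I \<in> info_states M"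
    and W: "W \<in> borel_measurable (info_borel M)" and b: "\<And>J. J \<in> info_states M \<Longrightarrow> \<bar>W J\<bar> \<le> b"
    and eq: "\<And>J. J \<in> info_states M \<Longrightarrow> action_value W J (f J) = W J"
  shows "policy_cost M (stationary f) I = W I"
proof -
  note \<gamma> = stationary_policy[OF f]
  let ?d = "\<lambda>z. action_value W (fst z) (snd z) - W (fst z)"
  have [measurable]: "(\<lambda>z. \<integral>J. W J \<partial>info_kernel M (fst z) (snd z)) \<in> borel_measurable (step_space M)"
    by (rule measurable_compose[OF measurable_prob_algebraD[OF info_kernel_measurable]
          integral_measurable_subprob_algebra[OF W]])
  note [measurable] = filt_cost_measurable measurable_compose[OF fst_step_space W]
  have dm: "Measurable.pred (step_space M) (\<lambda>z. ?d z = 0)"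
    unfolding action_value_def by measurable
  note Hp = history_law_prob[OF \<gamma> I]
  have "AE z in marginal (stationary f) I t. ?d z = 0" for t
    unfolding marginal_eq_bind[OF \<gamma> I]
  proof (subst AE_bind[OF _ dm])
    show "step_law M (stationary f) I t \<in> history_law (stationary f) I t \<rightarrow>\<^sub>M subprob_algebra (step_space M)"
      using measurable_prob_algebraD[OF step_law_measurable[OF \<gamma> I]] by (simp add: measurable_cong_sets[OF Hp(2) refl])
    have "AE z in step_law M (stationary f) I t h. ?d z = 0" if h: "h \<in> space (history_space t)" for h
      unfolding step_law_state_law
    proof (subst AE_bind[OF _ dm])
      show "(\<lambda>I'. stationary f t (h, I') \<bind> (\<lambda>u. return (step_space M) (I', u)))
          \<in> state_law I t h \<rightarrow>\<^sub>M subprob_algebra (step_space M)"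
        using measurable_prob_algebraD[OF action_law_section[OF \<gamma> h]]
        by (simp add: measurable_cong_sets[OF state_law_probability(2)[OF I h] refl])
      have "AE z in stationary f t (h, J) \<bind> (\<lambda>u. return (step_space M) (J, u)). ?d z = 0"
        if J: "J \<in> info_states M" for J
      proof -
        have "(\<lambda>u. (J, u)) \<in> borel \<rightarrow>\<^sub>M step_space M"
          unfolding step_space_def using J by (intro measurable_Pair1') (simp add: space_info_borel)
        from measurable_compose[OF this return_measurable]
        have bind: "stationary f t (h, J) \<bind> (\<lambda>u. return (step_space M) (J, u)) = return (step_space M) (J, f J)"
          unfolding stationary_def by (simp add: bind_return[where N="step_space M"])
        show ?thesis
          unfolding bind by (subst AE_return[OF _ dm]) (simp_all add: space_step_space J eq[OF J])
      qed
      then show "AE J in state_law I t h. AE z in stationary f t (h, J) \<bind> (\<lambda>u. return (step_space M) (J, u)). ?d z = 0"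
        by (rule AE_I2) (simp add: state_law_probability(3)[OF I h])
    qed
    then show "AE h in history_law (stationary f) I t. AE z in step_law M (stationary f) I t h. ?d z = 0"
      by (rule AE_I2) (simp add: Hp(3))
  qed
  then have "(\<integral>z. ?d z \<partial>marginal (stationary f) I t) = 0" for t
    by (rule integral_eq_zero_AE)
  with policy_cost_decomposition[OF \<gamma> I W b]
  have "(\<lambda>t. 0) sums (policy_cost M (stationary f) I - W I)" by simp
  from sums_unique2[OF this sums_zero] show ?thesis by simp
qed

end

section \<open>Optimality of the selector\<close>

theorem theorem7:
  fixes M :: "('x::polish_space, 'u::polish_space, 'e::polish_space, 'v::polish_space) pomdp"
    and C\<^sub>c :: real
  assumes model: "pomdp_model M"
    and cost_measurable: "(\<lambda>(x, u). cost M x u) \<in> borel_measurable (borel \<Otimes>\<^sub>M borel)"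
    and cost_bounded: "\<And>x u. \<bar>cost M x u\<bar> \<le> C\<^sub>c"
    and compact_actions: "compact (UNIV :: 'u set)"
    and cost_lsc: "lower_semicontinuous_map
      (prod_topology (info_topology M) (euclidean :: 'u topology)) (\<lambda>(I, u). filt_cost M I u)"
    and kernel_continuous: "weakly_continuous_kernel M"
  shows "opt_value M \<in> bounded_borel M \<and>
    (\<forall>I\<in>info_states M. opt_value M I = bellman M (opt_value M) I) \<and>
    (\<forall>V\<in>bounded_borel M. (\<forall>I\<in>info_states M. V I = bellman M V I) \<longrightarrow>
       (\<forall>I\<in>info_states M. V I = opt_value M I)) \<and>
    (\<exists>f \<in> info_borel M \<rightarrow>\<^sub>M borel.
       (\<forall>I\<in>info_states M. opt_value M I =
          filt_cost M I (f I) + disc M * (\<integral>I'. opt_value M I' \<partial>info_kernel M I (f I))) \<and>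
       (\<forall>I\<in>info_states M. policy_cost M (stationary f) I = opt_value M I))"
proof -
  interpret pomdp_model M by (rule model)
  interpret semicontinuous_pomdp M C\<^sub>c
    by unfold_locales (fact cost_bounded compact_actions cost_lsc kernel_continuous)+
  obtain W :: "'x info \<Rightarrow> real" and b where W: "lower_semicontinuous_map (info_topology M) W"
    "\<And>I. I \<in> info_states M \<Longrightarrow> \<bar>W I\<bar> \<le> b" "\<And>I. I \<in> info_states M \<Longrightarrow> W I = bellman M W I"
    using bellman_fixed_point by blast
  have Wm: "W \<in> borel_measurable (info_borel M)" by (rule lsc_info_borel_measurable[OF W(1)])
  obtain f where f: "f \<in> info_borel M \<rightarrow>\<^sub>M borel"
    "\<And>I. I \<in> info_states M \<Longrightarrow> action_value W I (f I) = bellman M W I"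
    using bellman_selector[OF W(1,2)] by blast
  have Jf: "policy_cost M (stationary f) I = W I" if "I \<in> info_states M" for I
    using f(2) W(3) by (intro stationary_policy_cost[OF f(1) that Wm W(2)]) auto
  have opt: "opt_value M I = W I" if I: "I \<in> info_states M" for I
    unfolding opt_value_def
  proof (rule cInf_eq_minimum)
    show "W I \<in> (\<lambda>\<gamma>. policy_cost M \<gamma> I) ` policies M"
      using Jf[OF I] stationary_policy[OF f(1)] by (intro image_eqI[of _ _ "stationary f"]) auto
    show "W I \<le> J" if "J \<in> (\<lambda>\<gamma>. policy_cost M \<gamma> I) ` policies M" for J
      using that policy_cost_ge[OF _ I Wm W(2)] W(3) by auto
  qed
  have optm: "opt_value M \<in> borel_measurable (info_borel M)"
    using Wm by (subst measurable_cong[where g=W]) (auto simp: space_info_borel opt)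
  have "bounded (opt_value M ` info_states M)"
    using W(2) by (intro boundedI[of _ b]) (auto simp: opt)
  then have opt_bounded_borel: "opt_value M \<in> bounded_borel M" using optm by (simp add: bounded_borel_def)
  have kernel: "(\<integral>J. opt_value M J \<partial>info_kernel M I u) = (\<integral>J. W J \<partial>info_kernel M I u)"
    if "I \<in> info_states M" for I u
    by (intro Bochner_Integration.integral_cong refl opt) (simp add: info_kernel_probability(3)[OF that])
  have unique: "V I = opt_value M I"
    if V: "V \<in> bounded_borel M" "\<forall>I\<in>info_states M. V I = bellman M V I" and I: "I \<in> info_states M" for V I
  proof -
    obtain b' where "\<And>J. J \<in> info_states M \<Longrightarrow> \<bar>V J\<bar> \<le> b'"
      using V(1) by (auto simp: bounded_borel_def bounded_iff)
    then have "V I = W I"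
      using V W(3) by (intro bellman_unique[OF _ _ _ Wm W(2) _ I]) (auto simp: bounded_borel_def)
    then show ?thesis by (simp add: opt[OF I])
  qed
  show ?thesis
  proof (intro conjI ballI impI bexI[OF _ f(1)])
    fix I assume I: "I \<in> info_states M"
    show "opt_value M I = bellman M (opt_value M) I"
      using W(3)[OF I] by (simp add: bellman_def kernel[OF I] opt[OF I])
    show "opt_value M I = filt_cost M I (f I) + disc M * (\<integral>I'. opt_value M I' \<partial>info_kernel M I (f I))"
      using f(2)[OF I] W(3)[OF I] by (simp add: action_value_def kernel[OF I] opt[OF I])
    show "policy_cost M (stationary f) I = opt_value M I" by (simp add: Jf[OF I] opt[OF I])
  qed (fact opt_bounded_borel unique)+
qed

end
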